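(* Let $E$ be a graph and let $R$ be a unital commutative ring. If $v\in E^0$, then the following are equivalent. (1) $L_R(E)v$ is a minimal left ideal of $L_R(E)$. (2) $vL_R(E)$ is a minimal right ideal of $L_R(E)$. (3) $v\in P_l(E)$ (i.e. $v$ is a line point) and $R$ is a field. (4) $vL_R(E)v=Rv$ and $R$ is a field.
   Context: A graph $E=(E^0,E^1,r,s)$ consists of countable sets $E^0$ (vertices) and $E^1$ (edges) and range and source maps $r,s:E^1\to E^0$. A path of length $n\ge 1$ is $\alpha=e_1\cdots e_n$ with $r(e_i)=s(e_{i+1})$; $s(\alpha)=s(e_1)$, $r(\alpha)=r(e_n)$; vertices are paths of length $0$. A closed path based at $v$ is a path of length $\ge1$ with source and range $v$. The tree of $v$ is $T(v):=\{w\in E^0:\text{there is a path from } v\text{ to }w\}$. A vertex is a bifurcation if it emits at least two edges. A vertex $v$ is a line point if no vertex $w\in T(v)$ is a bifurcation or the base of a closed path; $P_l(E)$ is the set of line points. For a unital commutative ring $R$, $L_R(E)$ is the universal $R$-algebra generated by pairwise orthogonal idempotents $\{v:v\in E^0\}$ and elements $\{e,e^*:e\in E^1\}$ subject to: $s(e)e=er(e)=e$; $r(e)e^*=e^*s(e)=e^*$; $e^*f=\delta_{e,f}r(e)$; and $v=\sum_{s(e)=v}ee^*$ whenever $0<|s^{-1}(v)|<\infty$. A minimal left (right) ideal is a nonzero left (right) ideal containing no nonzero left (right) ideal other than itself. *)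

theory Defs
  imports
    "HOL-Algebra.Module"
    "HOL-Algebra.AbelCoset"
    "HOL-Library.Countable_Set"
    "Graph_Theory.Digraph"
    "Graph_Theory.Arc_Walk"
begin

section \<open>Line points\<close>

text \<open>
  A graph \<open>(E0, E1, r, s)\<close> is a \<open>wf_digraph\<close> with countable vertex and arc sets, where
  \<open>tail\<close> is the source map \<open>s\<close> and \<open>head\<close> is the range map \<open>r\<close>. Loops, parallel arcs,
  sinks and vertices emitting infinitely many arcs are allowed. Paths are arc walks; the empty
  walk at a vertex is the path of length 0.
\<close>

definition bifurcation :: "('v, 'e) pre_digraph \<Rightarrow> 'v \<Rightarrow> bool" where
  "bifurcation E v \<longleftrightarrow> (\<exists>e\<in>out_arcs E v. \<exists>f\<in>out_arcs E v. e \<noteq> f)"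

definition closed_path_base :: "('v, 'e) pre_digraph \<Rightarrow> 'v \<Rightarrow> bool" where
  "closed_path_base E v \<longleftrightarrow> (\<exists>p. p \<noteq> [] \<and> pre_digraph.awalk E v p v)"

definition vertex_tree :: "('v, 'e) pre_digraph \<Rightarrow> 'v \<Rightarrow> 'v set" where
  "vertex_tree E v = {w \<in> verts E. \<exists>p. pre_digraph.awalk E v p w}"

definition line_points :: "('v, 'e) pre_digraph \<Rightarrow> 'v set" where
  "line_points E =
    {v \<in> verts E. \<forall>w\<in>vertex_tree E v. \<not> bifurcation E w \<and> \<not> closed_path_base E w}"


section \<open>Minimal one-sided ideals\<close>

text \<open>
  The multiplicative unit of the record is not used, so that these notions also make sense for
  rings without unit.
\<close>

definition left_ideal :: "'a set \<Rightarrow> ('a, 'm) ring_scheme \<Rightarrow> bool" where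
  "left_ideal I A \<longleftrightarrow> additive_subgroup I A \<and> (\<forall>x\<in>carrier A. \<forall>a\<in>I. x \<otimes>\<^bsub>A\<^esub> a \<in> I)"

definition right_ideal :: "'a set \<Rightarrow> ('a, 'm) ring_scheme \<Rightarrow> bool" where
  "right_ideal I A \<longleftrightarrow> additive_subgroup I A \<and> (\<forall>x\<in>carrier A. \<forall>a\<in>I. a \<otimes>\<^bsub>A\<^esub> x \<in> I)"

definition minimal_left_ideal :: "'a set \<Rightarrow> ('a, 'm) ring_scheme \<Rightarrow> bool" where
  "minimal_left_ideal I A \<longleftrightarrow> left_ideal I A \<and> I \<noteq> {\<zero>\<^bsub>A\<^esub>} \<and>
    (\<forall>J. left_ideal J A \<and> J \<noteq> {\<zero>\<^bsub>A\<^esub>} \<and> J \<subseteq> I \<longrightarrow> J = I)"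

definition minimal_right_ideal :: "'a set \<Rightarrow> ('a, 'm) ring_scheme \<Rightarrow> bool" where
  "minimal_right_ideal I A \<longleftrightarrow> right_ideal I A \<and> I \<noteq> {\<zero>\<^bsub>A\<^esub>} \<and>
    (\<forall>J. right_ideal J A \<and> J \<noteq> {\<zero>\<^bsub>A\<^esub>} \<and> J \<subseteq> I \<longrightarrow> J = I)"


section \<open>The Leavitt path algebra\<close>

text \<open>
  The universal \<open>R\<close>-algebra on generators and relations is built as a term algebra: formal
  expressions in the generators, modulo the least congruence that contains the axioms of an
  associative, not necessarily commutative or unital, \<open>R\<close>-algebra and the Leavitt relations.
  The universal property is proved at the end of this theory.
\<close>

datatype ('r, 'v, 'e) lpa_term =
    Vtx 'v
  | Edge 'e
  | Ghost 'e
  | Zer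
  | Plus "('r, 'v, 'e) lpa_term" "('r, 'v, 'e) lpa_term"
  | Neg "('r, 'v, 'e) lpa_term"
  | Times "('r, 'v, 'e) lpa_term" "('r, 'v, 'e) lpa_term"
  | Scale 'r "('r, 'v, 'e) lpa_term"

inductive_set lpa_terms ::
    "('r, 'x) ring_scheme \<Rightarrow> ('v, 'e) pre_digraph \<Rightarrow> ('r, 'v, 'e) lpa_term set"
  for R :: "('r, 'x) ring_scheme" and E :: "('v, 'e) pre_digraph"
where
  Vtx: "v \<in> verts E \<Longrightarrow> Vtx v \<in> lpa_terms R E"
| Edge: "e \<in> arcs E \<Longrightarrow> Edge e \<in> lpa_terms R E"
| Ghost: "e \<in> arcs E \<Longrightarrow> Ghost e \<in> lpa_terms R E"
| Zer: "Zer \<in> lpa_terms R E"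
| Plus: "a \<in> lpa_terms R E \<Longrightarrow> b \<in> lpa_terms R E \<Longrightarrow> Plus a b \<in> lpa_terms R E"
| Neg: "a \<in> lpa_terms R E \<Longrightarrow> Neg a \<in> lpa_terms R E"
| Times: "a \<in> lpa_terms R E \<Longrightarrow> b \<in> lpa_terms R E \<Longrightarrow> Times a b \<in> lpa_terms R E"
| Scale: "r \<in> carrier R \<Longrightarrow> a \<in> lpa_terms R E \<Longrightarrow> Scale r a \<in> lpa_terms R E"

text \<open>
  In rule \<open>ck2\<close> the finite sum over the arcs leaving \<open>v\<close> is written along an enumeration \<open>es\<close> of
  these arcs without repetition; such an enumeration exists iff \<open>v\<close> emits finitely many arcs.
\<close>

inductive lpa_cong ::
    "('r, 'x) ring_scheme \<Rightarrow> ('v, 'e) pre_digraph \<Rightarrow>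
      ('r, 'v, 'e) lpa_term \<Rightarrow> ('r, 'v, 'e) lpa_term \<Rightarrow> bool"
  for R :: "('r, 'x) ring_scheme" and E :: "('v, 'e) pre_digraph"
where
  refl: "a \<in> lpa_terms R E \<Longrightarrow> lpa_cong R E a a"
| sym: "lpa_cong R E a b \<Longrightarrow> lpa_cong R E b a"
| trans: "lpa_cong R E a b \<Longrightarrow> lpa_cong R E b c \<Longrightarrow> lpa_cong R E a c"
| cong_Plus: "lpa_cong R E a a' \<Longrightarrow> lpa_cong R E b b' \<Longrightarrow> lpa_cong R E (Plus a b) (Plus a' b')"
| cong_Neg: "lpa_cong R E a a' \<Longrightarrow> lpa_cong R E (Neg a) (Neg a')"
| cong_Times: "lpa_cong R E a a' \<Longrightarrow> lpa_cong R E b b' \<Longrightarrow> lpa_cong R E (Times a b) (Times a' b')"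
| cong_Scale: "r \<in> carrier R \<Longrightarrow> lpa_cong R E a a' \<Longrightarrow> lpa_cong R E (Scale r a) (Scale r a')"

| Plus_assoc: "a \<in> lpa_terms R E \<Longrightarrow> b \<in> lpa_terms R E \<Longrightarrow> c \<in> lpa_terms R E \<Longrightarrow>
    lpa_cong R E (Plus (Plus a b) c) (Plus a (Plus b c))"
| Plus_comm: "a \<in> lpa_terms R E \<Longrightarrow> b \<in> lpa_terms R E \<Longrightarrow> lpa_cong R E (Plus a b) (Plus b a)"
| Plus_Zer: "a \<in> lpa_terms R E \<Longrightarrow> lpa_cong R E (Plus Zer a) a"
| Plus_Neg: "a \<in> lpa_terms R E \<Longrightarrow> lpa_cong R E (Plus (Neg a) a) Zer"

| Times_assoc: "a \<in> lpa_terms R E \<Longrightarrow> b \<in> lpa_terms R E \<Longrightarrow> c \<in> lpa_terms R E \<Longrightarrow>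
    lpa_cong R E (Times (Times a b) c) (Times a (Times b c))"
| distrib_right: "a \<in> lpa_terms R E \<Longrightarrow> b \<in> lpa_terms R E \<Longrightarrow> c \<in> lpa_terms R E \<Longrightarrow>
    lpa_cong R E (Times (Plus a b) c) (Plus (Times a c) (Times b c))"
| distrib_left: "a \<in> lpa_terms R E \<Longrightarrow> b \<in> lpa_terms R E \<Longrightarrow> c \<in> lpa_terms R E \<Longrightarrow>
    lpa_cong R E (Times c (Plus a b)) (Plus (Times c a) (Times c b))"

| Scale_add: "r \<in> carrier R \<Longrightarrow> s \<in> carrier R \<Longrightarrow> a \<in> lpa_terms R E \<Longrightarrow>
    lpa_cong R E (Scale (r \<oplus>\<^bsub>R\<^esub> s) a) (Plus (Scale r a) (Scale s a))"
| Scale_Plus: "r \<in> carrier R \<Longrightarrow> a \<in> lpa_terms R E \<Longrightarrow> b \<in> lpa_terms R E \<Longrightarrow>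
    lpa_cong R E (Scale r (Plus a b)) (Plus (Scale r a) (Scale r b))"
| Scale_mult: "r \<in> carrier R \<Longrightarrow> s \<in> carrier R \<Longrightarrow> a \<in> lpa_terms R E \<Longrightarrow>
    lpa_cong R E (Scale (r \<otimes>\<^bsub>R\<^esub> s) a) (Scale r (Scale s a))"
| Scale_one: "a \<in> lpa_terms R E \<Longrightarrow> lpa_cong R E (Scale \<one>\<^bsub>R\<^esub> a) a"
| Scale_Times_left: "r \<in> carrier R \<Longrightarrow> a \<in> lpa_terms R E \<Longrightarrow> b \<in> lpa_terms R E \<Longrightarrow>
    lpa_cong R E (Times (Scale r a) b) (Scale r (Times a b))"
| Scale_Times_right: "r \<in> carrier R \<Longrightarrow> a \<in> lpa_terms R E \<Longrightarrow> b \<in> lpa_terms R E \<Longrightarrow>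
    lpa_cong R E (Times a (Scale r b)) (Scale r (Times a b))"

| vertex_idem: "v \<in> verts E \<Longrightarrow> lpa_cong R E (Times (Vtx v) (Vtx v)) (Vtx v)"
| vertex_orth: "v \<in> verts E \<Longrightarrow> w \<in> verts E \<Longrightarrow> v \<noteq> w \<Longrightarrow> lpa_cong R E (Times (Vtx v) (Vtx w)) Zer"
| edge_source: "e \<in> arcs E \<Longrightarrow> lpa_cong R E (Times (Vtx (tail E e)) (Edge e)) (Edge e)"
| edge_range: "e \<in> arcs E \<Longrightarrow> lpa_cong R E (Times (Edge e) (Vtx (head E e))) (Edge e)"
| ghost_range: "e \<in> arcs E \<Longrightarrow> lpa_cong R E (Times (Vtx (head E e)) (Ghost e)) (Ghost e)"
| ghost_source: "e \<in> arcs E \<Longrightarrow> lpa_cong R E (Times (Ghost e) (Vtx (tail E e))) (Ghost e)"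
| ck1_same: "e \<in> arcs E \<Longrightarrow> lpa_cong R E (Times (Ghost e) (Edge e)) (Vtx (head E e))"
| ck1_diff: "e \<in> arcs E \<Longrightarrow> f \<in> arcs E \<Longrightarrow> e \<noteq> f \<Longrightarrow> lpa_cong R E (Times (Ghost e) (Edge f)) Zer"
| ck2: "v \<in> verts E \<Longrightarrow> es \<noteq> [] \<Longrightarrow> distinct es \<Longrightarrow> set es = out_arcs E v \<Longrightarrow>
    lpa_cong R E (Vtx v) (foldr (\<lambda>e a. Plus (Times (Edge e) (Ghost e)) a) es Zer)"

definition lpa_rel ::
    "('r, 'x) ring_scheme \<Rightarrow> ('v, 'e) pre_digraph \<Rightarrow>
      (('r, 'v, 'e) lpa_term \<times> ('r, 'v, 'e) lpa_term) set" where
  "lpa_rel R E = {(a, b). lpa_cong R E a b}"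

definition lpa_class ::
    "('r, 'x) ring_scheme \<Rightarrow> ('v, 'e) pre_digraph \<Rightarrow>
      ('r, 'v, 'e) lpa_term \<Rightarrow> ('r, 'v, 'e) lpa_term set" where
  "lpa_class R E a = lpa_rel R E `` {a}"

text \<open>
  The Leavitt path algebra has a unit only if there are finitely many vertices, so the field
  \<open>one\<close> of the record is left unspecified; it must not be used.
\<close>

definition leavitt ::
    "('r, 'x) ring_scheme \<Rightarrow> ('v, 'e) pre_digraph \<Rightarrow> ('r, ('r, 'v, 'e) lpa_term set) module" where
  "leavitt R E =
    \<lparr> carrier = lpa_terms R E // lpa_rel R E,
      mult = (\<lambda>A B. \<Union>a\<in>A. \<Union>b\<in>B. lpa_class R E (Times a b)),
      one = undefined,
      zero = lpa_class R E Zer,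
      add = (\<lambda>A B. \<Union>a\<in>A. \<Union>b\<in>B. lpa_class R E (Plus a b)),
      smult = (\<lambda>r A. \<Union>a\<in>A. lpa_class R E (Scale r a)) \<rparr>"

definition lpa_vertex ::
    "('r, 'x) ring_scheme \<Rightarrow> ('v, 'e) pre_digraph \<Rightarrow> 'v \<Rightarrow> ('r, 'v, 'e) lpa_term set" where
  "lpa_vertex R E v = lpa_class R E (Vtx v)"

definition lpa_edge ::
    "('r, 'x) ring_scheme \<Rightarrow> ('v, 'e) pre_digraph \<Rightarrow> 'e \<Rightarrow> ('r, 'v, 'e) lpa_term set" where
  "lpa_edge R E e = lpa_class R E (Edge e)"

definition lpa_ghost ::
    "('r, 'x) ring_scheme \<Rightarrow> ('v, 'e) pre_digraph \<Rightarrow> 'e \<Rightarrow> ('r, 'v, 'e) lpa_term set" where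
  "lpa_ghost R E e = lpa_class R E (Ghost e)"


section \<open>The universal property\<close>

locale nonunital_algebra = Module.module R A
  for R :: "('r, 'x) ring_scheme" and A :: "('r, 'a, 'y) module_scheme" +
  assumes mult_closed: "x \<in> carrier A \<Longrightarrow> y \<in> carrier A \<Longrightarrow> x \<otimes>\<^bsub>A\<^esub> y \<in> carrier A"
    and mult_assoc: "x \<in> carrier A \<Longrightarrow> y \<in> carrier A \<Longrightarrow> z \<in> carrier A \<Longrightarrow>
      (x \<otimes>\<^bsub>A\<^esub> y) \<otimes>\<^bsub>A\<^esub> z = x \<otimes>\<^bsub>A\<^esub> (y \<otimes>\<^bsub>A\<^esub> z)"
    and distr_right: "x \<in> carrier A \<Longrightarrow> y \<in> carrier A \<Longrightarrow> z \<in> carrier A \<Longrightarrow>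
      (x \<oplus>\<^bsub>A\<^esub> y) \<otimes>\<^bsub>A\<^esub> z = x \<otimes>\<^bsub>A\<^esub> z \<oplus>\<^bsub>A\<^esub> y \<otimes>\<^bsub>A\<^esub> z"
    and distr_left: "x \<in> carrier A \<Longrightarrow> y \<in> carrier A \<Longrightarrow> z \<in> carrier A \<Longrightarrow>
      z \<otimes>\<^bsub>A\<^esub> (x \<oplus>\<^bsub>A\<^esub> y) = z \<otimes>\<^bsub>A\<^esub> x \<oplus>\<^bsub>A\<^esub> z \<otimes>\<^bsub>A\<^esub> y"
    and smult_mult_left: "r \<in> carrier R \<Longrightarrow> x \<in> carrier A \<Longrightarrow> y \<in> carrier A \<Longrightarrow>
      (r \<odot>\<^bsub>A\<^esub> x) \<otimes>\<^bsub>A\<^esub> y = r \<odot>\<^bsub>A\<^esub> (x \<otimes>\<^bsub>A\<^esub> y)"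
    and smult_mult_right: "r \<in> carrier R \<Longrightarrow> x \<in> carrier A \<Longrightarrow> y \<in> carrier A \<Longrightarrow>
      x \<otimes>\<^bsub>A\<^esub> (r \<odot>\<^bsub>A\<^esub> y) = r \<odot>\<^bsub>A\<^esub> (x \<otimes>\<^bsub>A\<^esub> y)"

locale leavitt_family = nonunital_algebra R A + wf_digraph E
  for R :: "('r, 'x) ring_scheme" and A :: "('r, 'a, 'y) module_scheme"
    and E :: "('v, 'e) pre_digraph" +
  fixes p :: "'v \<Rightarrow> 'a" and s :: "'e \<Rightarrow> 'a" and t :: "'e \<Rightarrow> 'a"
  assumes p_closed: "v \<in> verts E \<Longrightarrow> p v \<in> carrier A"
    and s_closed: "e \<in> arcs E \<Longrightarrow> s e \<in> carrier A"
    and t_closed: "e \<in> arcs E \<Longrightarrow> t e \<in> carrier A"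
    and p_mult: "v \<in> verts E \<Longrightarrow> w \<in> verts E \<Longrightarrow> p v \<otimes>\<^bsub>A\<^esub> p w = (if v = w then p v else \<zero>\<^bsub>A\<^esub>)"
    and p_s: "e \<in> arcs E \<Longrightarrow> p (tail E e) \<otimes>\<^bsub>A\<^esub> s e = s e"
    and s_p: "e \<in> arcs E \<Longrightarrow> s e \<otimes>\<^bsub>A\<^esub> p (head E e) = s e"
    and p_t: "e \<in> arcs E \<Longrightarrow> p (head E e) \<otimes>\<^bsub>A\<^esub> t e = t e"
    and t_p: "e \<in> arcs E \<Longrightarrow> t e \<otimes>\<^bsub>A\<^esub> p (tail E e) = t e"
    and t_s: "e \<in> arcs E \<Longrightarrow> f \<in> arcs E \<Longrightarrow> t e \<otimes>\<^bsub>A\<^esub> s f = (if e = f then p (head E e) else \<zero>\<^bsub>A\<^esub>)"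
    and p_sum: "v \<in> verts E \<Longrightarrow> out_arcs E v \<noteq> {} \<Longrightarrow> finite (out_arcs E v) \<Longrightarrow>
      p v = (\<Oplus>\<^bsub>A\<^esub>e\<in>out_arcs E v. s e \<otimes>\<^bsub>A\<^esub> t e)"

definition algebra_hom ::
    "('r, 'x) ring_scheme \<Rightarrow> ('r, 'a, 'y) module_scheme \<Rightarrow> ('r, 'b, 'z) module_scheme \<Rightarrow>
      ('a \<Rightarrow> 'b) \<Rightarrow> bool" where
  "algebra_hom R A B h \<longleftrightarrow> h \<in> carrier A \<rightarrow> carrier B \<and>
    (\<forall>x\<in>carrier A. \<forall>y\<in>carrier A.
      h (x \<oplus>\<^bsub>A\<^esub> y) = h x \<oplus>\<^bsub>B\<^esub> h y \<and> h (x \<otimes>\<^bsub>A\<^esub> y) = h x \<otimes>\<^bsub>B\<^esub> h y) \<and>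
    (\<forall>r\<in>carrier R. \<forall>x\<in>carrier A. h (r \<odot>\<^bsub>A\<^esub> x) = r \<odot>\<^bsub>B\<^esub> h x)"

lemma foldr_terms:
  "set es \<subseteq> arcs E \<Longrightarrow> foldr (\<lambda>e a. Plus (Times (Edge e) (Ghost e)) a) es Zer \<in> lpa_terms R E"
  by (induction es) (auto intro: lpa_terms.intros)

context
  fixes R :: "('r, 'x) ring_scheme" and E :: "('v, 'e) pre_digraph"
  assumes R: "cring R" and E: "wf_digraph E"
begin

lemma lpa_cong_terms:
  assumes "lpa_cong R E a b"
  shows "a \<in> lpa_terms R E" "b \<in> lpa_terms R E"
proof -
  interpret cring R by (rule R)
  interpret wf_digraph E by (rule E)
  have "a \<in> lpa_terms R E \<and> b \<in> lpa_terms R E"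
    using assms
  proof induction
    case (ck2 v es)
    then show ?case by (auto intro!: lpa_terms.Vtx foldr_terms)
  qed (auto intro!: lpa_terms.intros)
  then show "a \<in> lpa_terms R E" "b \<in> lpa_terms R E" by auto
qed

lemma equiv_lpa_rel: "equiv (lpa_terms R E) (lpa_rel R E)"
  unfolding lpa_rel_def
  by (intro equivI refl_onI symI transI)
     (auto intro: lpa_cong.refl lpa_cong.sym lpa_cong.trans dest: lpa_cong_terms)

lemma lpa_class_eq_iff:
  "a \<in> lpa_terms R E \<Longrightarrow> b \<in> lpa_terms R E \<Longrightarrow>
    lpa_class R E a = lpa_class R E b \<longleftrightarrow> lpa_cong R E a b"
  using eq_equiv_class_iff[OF equiv_lpa_rel] by (auto simp: lpa_class_def lpa_rel_def)

lemma lpa_class_eqI: "lpa_cong R E a b \<Longrightarrow> lpa_class R E a = lpa_class R E b"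
  using lpa_class_eq_iff lpa_cong_terms by blast

lemma leavitt_carrierE:
  assumes "x \<in> carrier (leavitt R E)"
  obtains a where "a \<in> lpa_terms R E" "x = lpa_class R E a"
  using assms by (auto simp: leavitt_def lpa_class_def elim: quotientE)

lemma lpa_class_closed: "a \<in> lpa_terms R E \<Longrightarrow> lpa_class R E a \<in> carrier (leavitt R E)"
  by (auto simp: leavitt_def lpa_class_def intro: quotientI)

lemma leavitt_zero: "\<zero>\<^bsub>leavitt R E\<^esub> = lpa_class R E Zer"
  by (simp add: leavitt_def)

lemma leavitt_add:
  assumes "a \<in> lpa_terms R E" "b \<in> lpa_terms R E"
  shows "lpa_class R E a \<oplus>\<^bsub>leavitt R E\<^esub> lpa_class R E b = lpa_class R E (Plus a b)"
proof -
  have "congruent2 (lpa_rel R E) (lpa_rel R E) (\<lambda>a b. lpa_class R E (Plus a b))"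
    by (auto simp: congruent2_def lpa_rel_def intro!: lpa_class_eqI lpa_cong.cong_Plus)
  from UN_equiv_class2[OF equiv_lpa_rel equiv_lpa_rel this assms] show ?thesis
    by (simp add: leavitt_def lpa_class_def)
qed

lemma leavitt_mult:
  assumes "a \<in> lpa_terms R E" "b \<in> lpa_terms R E"
  shows "lpa_class R E a \<otimes>\<^bsub>leavitt R E\<^esub> lpa_class R E b = lpa_class R E (Times a b)"
proof -
  have "congruent2 (lpa_rel R E) (lpa_rel R E) (\<lambda>a b. lpa_class R E (Times a b))"
    by (auto simp: congruent2_def lpa_rel_def intro!: lpa_class_eqI lpa_cong.cong_Times)
  from UN_equiv_class2[OF equiv_lpa_rel equiv_lpa_rel this assms] show ?thesis
    by (simp add: leavitt_def lpa_class_def)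
qed

lemma leavitt_smult:
  assumes "r \<in> carrier R" "a \<in> lpa_terms R E"
  shows "r \<odot>\<^bsub>leavitt R E\<^esub> lpa_class R E a = lpa_class R E (Scale r a)"
proof -
  have "congruent (lpa_rel R E) (\<lambda>a. lpa_class R E (Scale r a))"
    using assms(1)
    by (auto simp: congruent_def lpa_rel_def intro!: lpa_class_eqI lpa_cong.cong_Scale)
  from UN_equiv_class[OF equiv_lpa_rel this assms(2)] show ?thesis
    by (simp add: leavitt_def lpa_class_def)
qed

lemmas leavitt_ops = leavitt_zero leavitt_add leavitt_mult leavitt_smult

theorem leavitt_algebra: "nonunital_algebra R (leavitt R E)"
proof -
  interpret R: cring R by (rule R)
  let ?L = "leavitt R E"
  have ag: "abelian_group ?L"
  proof (rule abelian_groupI)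
    fix x assume "x \<in> carrier ?L"
    then obtain a where a: "a \<in> lpa_terms R E" "x = lpa_class R E a" by (rule leavitt_carrierE)
    then have "lpa_class R E (Neg a) \<oplus>\<^bsub>?L\<^esub> x = \<zero>\<^bsub>?L\<^esub>"
      by (auto simp: leavitt_ops lpa_terms.intros intro!: lpa_class_eqI lpa_cong.intros)
    with a show "\<exists>y\<in>carrier ?L. y \<oplus>\<^bsub>?L\<^esub> x = \<zero>\<^bsub>?L\<^esub>"
      by (auto intro: lpa_class_closed lpa_terms.intros)
  qed (auto elim!: leavitt_carrierE simp: leavitt_ops lpa_terms.intros lpa_class_eq_iff
        intro!: lpa_class_closed intro: lpa_terms.intros lpa_cong.Plus_assoc
          lpa_cong.Plus_comm lpa_cong.Plus_Zer del: equalityI)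
  have mod: "Module.module R ?L"
    by (rule moduleI[OF R ag])
      (auto elim!: leavitt_carrierE simp: leavitt_ops lpa_terms.intros lpa_class_eq_iff
        intro!: lpa_class_closed intro: lpa_terms.intros lpa_cong.Scale_add
          lpa_cong.Scale_Plus lpa_cong.Scale_mult lpa_cong.Scale_one del: equalityI)
  show ?thesis
    by (intro nonunital_algebra.intro mod nonunital_algebra_axioms.intro)
      (auto elim!: leavitt_carrierE simp: leavitt_ops lpa_terms.intros lpa_class_eq_iff
        intro!: lpa_class_closed intro: lpa_terms.intros lpa_cong.Times_assoc
          lpa_cong.distrib_right lpa_cong.distrib_left lpa_cong.Scale_Times_left
          lpa_cong.Scale_Times_right del: equalityI)
qed

theorem leavitt_family_leavitt:
  "leavitt_family R (leavitt R E) E (lpa_vertex R E) (lpa_edge R E) (lpa_ghost R E)"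
proof -
  let ?L = "leavitt R E"
  interpret L: nonunital_algebra R ?L by (rule leavitt_algebra)
  interpret wf_digraph E by (rule E)
  have sum: "set es \<subseteq> arcs E \<Longrightarrow> distinct es \<Longrightarrow>
      (\<Oplus>\<^bsub>?L\<^esub>e\<in>set es. lpa_edge R E e \<otimes>\<^bsub>?L\<^esub> lpa_ghost R E e) =
        lpa_class R E (foldr (\<lambda>e a. Plus (Times (Edge e) (Ghost e)) a) es Zer)" for es
  proof (induction es)
    case Nil
    then show ?case by (simp add: leavitt_zero)
  next
    case (Cons e es)
    have "(\<lambda>e. lpa_edge R E e \<otimes>\<^bsub>?L\<^esub> lpa_ghost R E e) \<in> set (e # es) \<rightarrow> carrier ?L"
      using Cons.prems
      by (auto simp: lpa_edge_def lpa_ghost_def intro!: L.mult_closed lpa_class_closed lpa_terms.intros)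
    with Cons show ?case
      by (auto simp: L.M.finsum_insert lpa_edge_def lpa_ghost_def leavitt_ops foldr_terms
          lpa_terms.intros)
  qed
  show ?thesis
  proof (intro leavitt_family.intro leavitt_family_axioms.intro leavitt_algebra E)
    fix v assume v: "v \<in> verts E" "out_arcs E v \<noteq> {}" "finite (out_arcs E v)"
    then obtain es where es: "set es = out_arcs E v" "distinct es"
      using finite_distinct_list by blast
    have "lpa_vertex R E v = lpa_class R E (foldr (\<lambda>e a. Plus (Times (Edge e) (Ghost e)) a) es Zer)"
      unfolding lpa_vertex_def using v es by (intro lpa_class_eqI lpa_cong.ck2) auto
    also have "\<dots> = (\<Oplus>\<^bsub>?L\<^esub>e\<in>set es. lpa_edge R E e \<otimes>\<^bsub>?L\<^esub> lpa_ghost R E e)"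
      using es by (subst sum) auto
    finally show "lpa_vertex R E v = (\<Oplus>\<^bsub>?L\<^esub>e\<in>out_arcs E v. lpa_edge R E e \<otimes>\<^bsub>?L\<^esub> lpa_ghost R E e)"
      by (simp add: es)
  qed (auto simp: lpa_vertex_def lpa_edge_def lpa_ghost_def leavitt_ops lpa_terms.intros
        lpa_class_eq_iff
      intro!: lpa_class_closed
      intro: lpa_terms.intros lpa_cong.vertex_idem lpa_cong.vertex_orth lpa_cong.edge_source
        lpa_cong.edge_range lpa_cong.ghost_range lpa_cong.ghost_source lpa_cong.ck1_same
        lpa_cong.ck1_diff del: equalityI)
qed

end

context leavitt_family
begin

primrec lift :: "('r, 'v, 'e) lpa_term \<Rightarrow> 'a" where
  "lift (Vtx v) = p v"
| "lift (Edge e) = s e"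
| "lift (Ghost e) = t e"
| "lift Zer = \<zero>\<^bsub>A\<^esub>"
| "lift (Plus a b) = lift a \<oplus>\<^bsub>A\<^esub> lift b"
| "lift (Neg a) = \<ominus>\<^bsub>A\<^esub> lift a"
| "lift (Times a b) = lift a \<otimes>\<^bsub>A\<^esub> lift b"
| "lift (Scale r a) = r \<odot>\<^bsub>A\<^esub> lift a"

lemma lift_closed: "a \<in> lpa_terms R E \<Longrightarrow> lift a \<in> carrier A"
  by (induction rule: lpa_terms.induct) (auto simp: p_closed s_closed t_closed mult_closed)

lemma lift_foldr:
  assumes "set es \<subseteq> arcs E" "distinct es"
  shows "lift (foldr (\<lambda>e a. Plus (Times (Edge e) (Ghost e)) a) es Zer) =
    (\<Oplus>\<^bsub>A\<^esub>e\<in>set es. s e \<otimes>\<^bsub>A\<^esub> t e)"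
  using assms
proof (induction es)
  case (Cons e es)
  then have "(\<lambda>e. s e \<otimes>\<^bsub>A\<^esub> t e) \<in> set (e # es) \<rightarrow> carrier A"
    by (auto intro!: mult_closed s_closed t_closed)
  with Cons show ?case by (auto simp: M.finsum_insert)
qed simp

lemma lift_cong: "lpa_cong R E a b \<Longrightarrow> lift a = lift b"
proof (induction rule: lpa_cong.induct)
  case (ck2 v es)
  then have "out_arcs E v \<noteq> {}" "finite (out_arcs E v)"
    by (metis set_empty, metis List.finite_set)
  with ck2 have "lift (foldr (\<lambda>e a. Plus (Times (Edge e) (Ghost e)) a) es Zer) = p v"
    by (subst lift_foldr) (auto simp: p_sum)
  then show ?case by simp
qed (auto simp: lift_closed p_closed s_closed t_closed mult_closed mult_assoc distr_left
    distr_right smult_l_distr smult_r_distr smult_assoc1 smult_mult_left smult_mult_right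
    p_mult p_s s_p p_t t_p t_s M.a_ac M.l_neg M.r_neg)

theorem leavitt_universal:
  "\<exists>h. algebra_hom R (leavitt R E) A h \<and>
    (\<forall>v\<in>verts E. h (lpa_vertex R E v) = p v) \<and>
    (\<forall>e\<in>arcs E. h (lpa_edge R E e) = s e \<and> h (lpa_ghost R E e) = t e)"
  (is "\<exists>h. ?P h")
proof -
  define h where "h x = lift (SOME a. a \<in> x)" for x
  note ctx = R.cring_axioms wf_digraph_axioms
  have h: "h (lpa_class R E a) = lift a" if "a \<in> lpa_terms R E" for a
  proof -
    have "a \<in> lpa_class R E a" using that by (auto simp: lpa_class_def lpa_rel_def intro: lpa_cong.refl)
    then have "(SOME b. b \<in> lpa_class R E a) \<in> lpa_class R E a" by (rule someI)
    then show ?thesis by (auto simp: h_def lpa_class_def lpa_rel_def dest: lift_cong)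
  qed
  have "?P h"
    by (auto simp: algebra_hom_def h lift_closed leavitt_ops[OF ctx] lpa_terms.intros
        lpa_vertex_def lpa_edge_def lpa_ghost_def elim!: leavitt_carrierE[OF ctx])
  then show ?thesis by blast
qed

theorem leavitt_universal_unique:
  assumes g: "algebra_hom R (leavitt R E) A g"
    and h: "algebra_hom R (leavitt R E) A h"
    and "\<And>v. v \<in> verts E \<Longrightarrow> g (lpa_vertex R E v) = h (lpa_vertex R E v)"
    and "\<And>e. e \<in> arcs E \<Longrightarrow> g (lpa_edge R E e) = h (lpa_edge R E e)"
    and "\<And>e. e \<in> arcs E \<Longrightarrow> g (lpa_ghost R E e) = h (lpa_ghost R E e)"
    and "x \<in> carrier (leavitt R E)"
  shows "g x = h x"
proof -
  note ctx = R.cring_axioms wf_digraph_axioms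
  note ops = leavitt_ops[OF ctx] and cl = lpa_class_closed[OF ctx]
  interpret L: nonunital_algebra R "leavitt R E" by (rule leavitt_algebra[OF ctx])
  have add: "k (lpa_class R E (Plus a b)) = k (lpa_class R E a) \<oplus>\<^bsub>A\<^esub> k (lpa_class R E b)"
    and mul: "k (lpa_class R E (Times a b)) = k (lpa_class R E a) \<otimes>\<^bsub>A\<^esub> k (lpa_class R E b)"
    if "algebra_hom R (leavitt R E) A k" "a \<in> lpa_terms R E" "b \<in> lpa_terms R E" for k a b
    using that cl[OF that(2)] cl[OF that(3)] by (auto simp: algebra_hom_def ops[symmetric])
  have scl: "k (lpa_class R E (Scale r a)) = r \<odot>\<^bsub>A\<^esub> k (lpa_class R E a)"
    if "algebra_hom R (leavitt R E) A k" "r \<in> carrier R" "a \<in> lpa_terms R E" for k r a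
    using that cl[OF that(3)] by (auto simp: algebra_hom_def ops[symmetric])
  have zer: "k (lpa_class R E Zer) = \<zero>\<^bsub>A\<^esub>" if k: "algebra_hom R (leavitt R E) A k" for k
  proof -
    have "lpa_class R E (Scale \<zero>\<^bsub>R\<^esub> Zer) = lpa_class R E Zer"
      using L.smult_l_null[OF cl[OF lpa_terms.Zer]] by (simp add: ops lpa_terms.intros)
    moreover have "k (lpa_class R E Zer) \<in> carrier A"
      using k cl[OF lpa_terms.Zer] by (auto simp: algebra_hom_def)
    ultimately show ?thesis
      using scl[OF k R.zero_closed lpa_terms.Zer] by simp
  qed
  have neg: "lpa_class R E (Neg a) = lpa_class R E (Scale (\<ominus>\<^bsub>R\<^esub> \<one>\<^bsub>R\<^esub>) a)"
    if a: "a \<in> lpa_terms R E" for a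
  proof -
    have "lpa_class R E (Neg a) \<oplus>\<^bsub>leavitt R E\<^esub> lpa_class R E a = \<zero>\<^bsub>leavitt R E\<^esub>"
      using a by (auto simp: ops lpa_terms.intros intro!: lpa_class_eqI[OF ctx] lpa_cong.Plus_Neg)
    then have "lpa_class R E (Neg a) = \<ominus>\<^bsub>leavitt R E\<^esub> lpa_class R E a"
      using a by (intro L.M.minus_equality[symmetric]) (auto intro: cl lpa_terms.intros)
    also have "\<dots> = (\<ominus>\<^bsub>R\<^esub> \<one>\<^bsub>R\<^esub>) \<odot>\<^bsub>leavitt R E\<^esub> lpa_class R E a"
      using a by (simp add: L.smult_l_minus cl)
    finally show ?thesis using a by (simp add: ops)
  qed
  obtain a where a: "a \<in> lpa_terms R E" "x = lpa_class R E a"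
    using assms(6) by (rule leavitt_carrierE[OF ctx])
  from a(1) have "g (lpa_class R E a) = h (lpa_class R E a)"
  proof induction
    case (Neg a)
    then show ?case by (simp add: neg scl[OF g] scl[OF h])
  qed (use assms(3-5) in \<open>auto simp: lpa_vertex_def lpa_edge_def lpa_ghost_def
      add[OF g] add[OF h] mul[OF g] mul[OF h] scl[OF g] scl[OF h] zer[OF g] zer[OF h]\<close>)
  with a show ?thesis by simp
qed

end

end

theory Submission
  imports Defs
begin

text \<open>
  Write \<open>L\<close> for the Leavitt path algebra; a path \<open>\<alpha>\<close> from \<open>u\<close> to \<open>w\<close> has a ghost \<open>\<alpha>*\<close> with
  \<open>\<alpha>* \<alpha> = w\<close>. The involution of \<open>L\<close> that exchanges paths and ghosts turns \<open>L v\<close> into \<open>v L\<close>, so only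
  left ideals need to be studied (\<open>minimal_left_iff_minimal_right\<close>). For them one goes round a
  triangle: minimality implies line point and field, these imply \<open>v L v = R v\<close>, and this implies
  minimality.

  The central tool is \<open>ghost_separates\<close>: a nonzero element of \<open>L v\<close> is not annihilated by all ghosts
  \<open>\<alpha>*\<close> of paths that end in the tree of \<open>v\<close>. It shows that \<open>L x\<close> is nonzero for nonzero \<open>x\<close>, hence the criterion
  \<open>minimal_left_ideal_iff\<close>: \<open>L v\<close> is minimal iff \<open>v\<close> is nonzero and a left multiple of every nonzero
  element of \<open>L v\<close>. It also settles the last side of the triangle: if \<open>\<alpha>* x\<close> is nonzero, and \<open>\<beta>\<close> runs
  from \<open>v\<close> to the end of \<open>\<alpha>\<close>, then \<open>\<beta> \<alpha>* x\<close> is a nonzero element of \<open>v L v = R v\<close>, so after division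
  by a scalar it is \<open>v\<close>.

  If \<open>v\<close> is a line point, two paths from \<open>v\<close> with the same end are equal, and \<open>\<alpha> \<alpha>* = v\<close> for each such
  path because every vertex on the way emits a single arc. As \<open>v L v\<close> is spanned by monomials
  \<open>\<alpha> \<beta>*\<close> of such paths, it equals \<open>R v\<close> (\<open>line_point_corner\<close>).

  Finally let \<open>L v\<close> be minimal. Then \<open>L w\<close> is minimal for every \<open>w\<close> in the tree of \<open>v\<close>, because right
  multiplication by a path from \<open>v\<close> to \<open>w\<close> and by its ghost relate the two ideals. Three elements
  of \<open>L w\<close> cannot have \<open>w\<close> as a left multiple: \<open>r w\<close> for a nonzero nonunit \<open>r\<close>, \<open>e e*\<close> if \<open>e\<close> is one of
  several arcs leaving \<open>w\<close>, and \<open>w - \<gamma>*\<close> for a closed path \<open>\<gamma>\<close> at \<open>w\<close>. That these elements are nonzero,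
  and that \<open>w\<close> is no left multiple of the first and the last, is read off from a graded representation
  of \<open>L\<close> on functions, in which the constant function \<open>1\<close> is killed by \<open>w - \<gamma>*\<close>.
\<close>

section \<open>Elements of a Leavitt family given by paths\<close>

context nonunital_algebra
begin

lemma zero_mult: "x \<in> carrier A \<Longrightarrow> \<zero>\<^bsub>A\<^esub> \<otimes>\<^bsub>A\<^esub> x = \<zero>\<^bsub>A\<^esub>"
  by (metis M.zero_closed R.zero_closed mult_closed smult_l_null smult_mult_left)

lemma mult_zero: "x \<in> carrier A \<Longrightarrow> x \<otimes>\<^bsub>A\<^esub> \<zero>\<^bsub>A\<^esub> = \<zero>\<^bsub>A\<^esub>"
  by (metis M.zero_closed R.zero_closed mult_closed smult_l_null smult_mult_right)

lemma a_inv_eq_smult: "x \<in> carrier A \<Longrightarrow> \<ominus>\<^bsub>A\<^esub> x = (\<ominus>\<^bsub>R\<^esub> \<one>\<^bsub>R\<^esub>) \<odot>\<^bsub>A\<^esub> x"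
  by (simp add: smult_l_minus)

lemma mult_minus_right:
  assumes "x \<in> carrier A" "y \<in> carrier A" "z \<in> carrier A"
  shows "x \<otimes>\<^bsub>A\<^esub> (y \<ominus>\<^bsub>A\<^esub> z) = x \<otimes>\<^bsub>A\<^esub> y \<ominus>\<^bsub>A\<^esub> x \<otimes>\<^bsub>A\<^esub> z"
  using assms by (simp add: M.minus_eq a_inv_eq_smult distr_left smult_mult_right mult_closed)

lemma mult_minus_left:
  assumes "x \<in> carrier A" "y \<in> carrier A" "z \<in> carrier A"
  shows "(y \<ominus>\<^bsub>A\<^esub> z) \<otimes>\<^bsub>A\<^esub> x = y \<otimes>\<^bsub>A\<^esub> x \<ominus>\<^bsub>A\<^esub> z \<otimes>\<^bsub>A\<^esub> x"
  using assms by (simp add: M.minus_eq a_inv_eq_smult distr_right smult_mult_left mult_closed)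

end

context leavitt_family
begin

primrec path_elt :: "'v \<Rightarrow> 'e list \<Rightarrow> 'a" where
  "path_elt u [] = p u"
| "path_elt u (e # es) = s e \<otimes>\<^bsub>A\<^esub> path_elt (head E e) es"

primrec ghost_elt :: "'v \<Rightarrow> 'e list \<Rightarrow> 'a" where
  "ghost_elt u [] = p u"
| "ghost_elt u (e # es) = ghost_elt (head E e) es \<otimes>\<^bsub>A\<^esub> t e"

lemmas gen_closed = p_closed s_closed t_closed mult_closed

lemma path_elt_closed: "awalk u \<alpha> w \<Longrightarrow> path_elt u \<alpha> \<in> carrier A"
  by (induction \<alpha> arbitrary: u) (auto simp: awalk_simps gen_closed)

lemma ghost_elt_closed: "awalk u \<alpha> w \<Longrightarrow> ghost_elt u \<alpha> \<in> carrier A"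
  by (induction \<alpha> arbitrary: u) (auto simp: awalk_simps gen_closed)

lemmas elt_closed = gen_closed path_elt_closed ghost_elt_closed

lemma vertex_path_elt: "awalk u \<alpha> w \<Longrightarrow> p u \<otimes>\<^bsub>A\<^esub> path_elt u \<alpha> = path_elt u \<alpha>"
  by (cases \<alpha>) (auto simp: awalk_simps p_mult p_s elt_closed simp flip: mult_assoc)

lemma path_elt_vertex: "awalk u \<alpha> w \<Longrightarrow> path_elt u \<alpha> \<otimes>\<^bsub>A\<^esub> p w = path_elt u \<alpha>"
  by (induction \<alpha> arbitrary: u)
    (auto simp: awalk_simps p_mult elt_closed mult_assoc awalk_last_in_verts)

lemma ghost_elt_vertex: "awalk u \<alpha> w \<Longrightarrow> ghost_elt u \<alpha> \<otimes>\<^bsub>A\<^esub> p u = ghost_elt u \<alpha>"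
  by (cases \<alpha>) (auto simp: awalk_simps p_mult t_p elt_closed mult_assoc)

lemma vertex_ghost_elt: "awalk u \<alpha> w \<Longrightarrow> p w \<otimes>\<^bsub>A\<^esub> ghost_elt u \<alpha> = ghost_elt u \<alpha>"
proof (induction \<alpha> arbitrary: u)
  case (Cons e \<alpha>)
  then have "p w \<otimes>\<^bsub>A\<^esub> (ghost_elt (head E e) \<alpha> \<otimes>\<^bsub>A\<^esub> t e)
      = (p w \<otimes>\<^bsub>A\<^esub> ghost_elt (head E e) \<alpha>) \<otimes>\<^bsub>A\<^esub> t e"
    by (subst mult_assoc) (auto simp: awalk_simps elt_closed awalk_last_in_verts)
  with Cons show ?case by (auto simp: awalk_simps)
qed (auto simp: awalk_simps p_mult)

lemma vertex_mult_path:
  assumes "z \<in> verts E" "awalk u \<alpha> w"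
  shows "p z \<otimes>\<^bsub>A\<^esub> path_elt u \<alpha> = (if z = u then path_elt u \<alpha> else \<zero>\<^bsub>A\<^esub>)"
proof -
  have u: "u \<in> verts E" using assms(2) by blast
  have "p z \<otimes>\<^bsub>A\<^esub> path_elt u \<alpha> = p z \<otimes>\<^bsub>A\<^esub> (p u \<otimes>\<^bsub>A\<^esub> path_elt u \<alpha>)"
    using assms by (simp add: vertex_path_elt)
  also have "\<dots> = (p z \<otimes>\<^bsub>A\<^esub> p u) \<otimes>\<^bsub>A\<^esub> path_elt u \<alpha>"
    using assms u by (simp add: mult_assoc elt_closed path_elt_closed[OF assms(2)])
  also have "\<dots> = (if z = u then path_elt u \<alpha> else \<zero>\<^bsub>A\<^esub>)"
    using assms u by (simp add: p_mult vertex_path_elt[OF assms(2)] zero_mult path_elt_closed[OF assms(2)])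
  finally show ?thesis .
qed

lemma ghost_mult_vertex:
  assumes "z \<in> verts E" "awalk u \<alpha> w"
  shows "ghost_elt u \<alpha> \<otimes>\<^bsub>A\<^esub> p z = (if z = u then ghost_elt u \<alpha> else \<zero>\<^bsub>A\<^esub>)"
proof -
  have u: "u \<in> verts E" using assms(2) by blast
  have "ghost_elt u \<alpha> \<otimes>\<^bsub>A\<^esub> p z = (ghost_elt u \<alpha> \<otimes>\<^bsub>A\<^esub> p u) \<otimes>\<^bsub>A\<^esub> p z"
    using assms by (simp add: ghost_elt_vertex)
  also have "\<dots> = ghost_elt u \<alpha> \<otimes>\<^bsub>A\<^esub> (p u \<otimes>\<^bsub>A\<^esub> p z)"
    using assms u by (simp add: mult_assoc elt_closed ghost_elt_closed[OF assms(2)])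
  also have "\<dots> = (if z = u then ghost_elt u \<alpha> else \<zero>\<^bsub>A\<^esub>)"
    using assms u by (simp add: p_mult ghost_elt_vertex[OF assms(2)] mult_zero ghost_elt_closed[OF assms(2)])
  finally show ?thesis .
qed

lemma edge_mult_path:
  assumes "e \<in> arcs E" "awalk u \<alpha> w"
  shows "s e \<otimes>\<^bsub>A\<^esub> path_elt u \<alpha> = (if head E e = u then path_elt (tail E e) (e # \<alpha>) else \<zero>\<^bsub>A\<^esub>)"
proof -
  have "s e \<otimes>\<^bsub>A\<^esub> path_elt u \<alpha> = (s e \<otimes>\<^bsub>A\<^esub> p (head E e)) \<otimes>\<^bsub>A\<^esub> path_elt u \<alpha>"
    using assms by (simp add: s_p)
  also have "\<dots> = s e \<otimes>\<^bsub>A\<^esub> (p (head E e) \<otimes>\<^bsub>A\<^esub> path_elt u \<alpha>)"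
    using assms by (simp add: mult_assoc elt_closed path_elt_closed[OF assms(2)])
  also have "\<dots> = (if head E e = u then path_elt (tail E e) (e # \<alpha>) else \<zero>\<^bsub>A\<^esub>)"
    using assms by (simp add: vertex_mult_path[OF _ assms(2)] mult_zero elt_closed)
  finally show ?thesis .
qed

lemma ghost_edge_mult_path:
  assumes "e \<in> arcs E" "awalk u (f # \<alpha>) w"
  shows "t e \<otimes>\<^bsub>A\<^esub> path_elt u (f # \<alpha>) = (if e = f then path_elt (head E f) \<alpha> else \<zero>\<^bsub>A\<^esub>)"
proof -
  have f: "f \<in> arcs E" and \<alpha>: "awalk (head E f) \<alpha> w" using assms by (auto simp: awalk_simps)
  have "t e \<otimes>\<^bsub>A\<^esub> path_elt u (f # \<alpha>) = (t e \<otimes>\<^bsub>A\<^esub> s f) \<otimes>\<^bsub>A\<^esub> path_elt (head E f) \<alpha>"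
    using assms f by (simp add: mult_assoc elt_closed path_elt_closed[OF \<alpha>])
  with assms f show ?thesis
    by (simp add: t_s vertex_path_elt[OF \<alpha>] zero_mult path_elt_closed[OF \<alpha>])
qed

lemma ghost_elt_snoc:
  assumes "e \<in> arcs E" "awalk v \<beta> (tail E e)"
  shows "ghost_elt v (\<beta> @ [e]) = t e \<otimes>\<^bsub>A\<^esub> ghost_elt v \<beta>"
  using assms(2)
proof (induction \<beta> arbitrary: v)
  case Nil
  with assms(1) show ?case by (auto simp: awalk_simps p_t t_p)
next
  case (Cons f \<beta>)
  then have f: "f \<in> arcs E" and \<beta>: "awalk (head E f) \<beta> (tail E e)" by (auto simp: awalk_simps)
  show ?case
    using Cons.IH[OF \<beta>] assms(1) f by (simp add: mult_assoc elt_closed ghost_elt_closed[OF \<beta>])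
qed

lemma ghost_edge_mult_ghost:
  assumes "e \<in> arcs E" "awalk v \<beta> w"
  shows "t e \<otimes>\<^bsub>A\<^esub> ghost_elt v \<beta> = (if tail E e = w then ghost_elt v (\<beta> @ [e]) else \<zero>\<^bsub>A\<^esub>)"
proof (cases "tail E e = w")
  case True
  with assms show ?thesis by (simp add: ghost_elt_snoc)
next
  case False
  have w: "w \<in> verts E" using assms(2) by blast
  have "t e \<otimes>\<^bsub>A\<^esub> ghost_elt v \<beta> = (t e \<otimes>\<^bsub>A\<^esub> p (tail E e)) \<otimes>\<^bsub>A\<^esub> (p w \<otimes>\<^bsub>A\<^esub> ghost_elt v \<beta>)"
    using assms by (simp add: t_p vertex_ghost_elt[OF assms(2)])
  also have "\<dots> = t e \<otimes>\<^bsub>A\<^esub> ((p (tail E e) \<otimes>\<^bsub>A\<^esub> p w) \<otimes>\<^bsub>A\<^esub> ghost_elt v \<beta>)"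
    using assms w by (simp add: mult_assoc elt_closed ghost_elt_closed[OF assms(2)])
  also have "\<dots> = \<zero>\<^bsub>A\<^esub>"
    using assms w False by (simp add: p_mult zero_mult mult_zero elt_closed ghost_elt_closed[OF assms(2)])
  finally show ?thesis using False by simp
qed

lemma ghost_path_elt: "awalk u \<alpha> w \<Longrightarrow> ghost_elt u \<alpha> \<otimes>\<^bsub>A\<^esub> path_elt u \<alpha> = p w"
proof (induction \<alpha> arbitrary: u)
  case Nil
  then show ?case by (auto simp: awalk_simps p_mult)
next
  case (Cons e \<alpha>)
  then have e: "e \<in> arcs E" and \<alpha>: "awalk (head E e) \<alpha> w" by (auto simp: awalk_simps)
  have "ghost_elt u (e # \<alpha>) \<otimes>\<^bsub>A\<^esub> path_elt u (e # \<alpha>)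
      = ghost_elt (head E e) \<alpha> \<otimes>\<^bsub>A\<^esub> (t e \<otimes>\<^bsub>A\<^esub> path_elt u (e # \<alpha>))"
    using Cons.prems e by (simp add: mult_assoc elt_closed path_elt_closed[OF \<alpha>] ghost_elt_closed[OF \<alpha>])
  also have "\<dots> = p w"
    using Cons.prems e by (simp add: ghost_edge_mult_path Cons.IH[OF \<alpha>] del: path_elt.simps)
  finally show ?case .
qed

definition path_proj :: "'v \<Rightarrow> 'e list \<Rightarrow> 'a" where
  "path_proj u \<alpha> = path_elt u \<alpha> \<otimes>\<^bsub>A\<^esub> ghost_elt u \<alpha>"

lemma path_proj_closed: "awalk u \<alpha> w \<Longrightarrow> path_proj u \<alpha> \<in> carrier A"
  by (simp add: path_proj_def elt_closed)

lemma path_proj_Nil: "u \<in> verts E \<Longrightarrow> path_proj u [] = p u"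
  by (simp add: path_proj_def p_mult)

lemma path_proj_Cons:
  assumes "awalk u (e # \<alpha>) w"
  shows "path_proj u (e # \<alpha>) = s e \<otimes>\<^bsub>A\<^esub> (path_proj (head E e) \<alpha> \<otimes>\<^bsub>A\<^esub> t e)"
proof -
  have e: "e \<in> arcs E" and \<alpha>: "awalk (head E e) \<alpha> w" using assms by (auto simp: awalk_simps)
  show ?thesis using e
    by (simp add: path_proj_def mult_assoc elt_closed path_elt_closed[OF \<alpha>] ghost_elt_closed[OF \<alpha>])
qed

lemma vertex_mult_proj:
  assumes "z \<in> verts E" "awalk u \<alpha> w"
  shows "p z \<otimes>\<^bsub>A\<^esub> path_proj u \<alpha> = (if z = u then path_proj u \<alpha> else \<zero>\<^bsub>A\<^esub>)"
  using assms vertex_mult_path[OF assms]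
  by (simp add: path_proj_def elt_closed path_elt_closed[OF assms(2)] ghost_elt_closed[OF assms(2)]
      zero_mult flip: mult_assoc)

lemma proj_mult_vertex:
  assumes "z \<in> verts E" "awalk u \<alpha> w"
  shows "path_proj u \<alpha> \<otimes>\<^bsub>A\<^esub> p z = (if z = u then path_proj u \<alpha> else \<zero>\<^bsub>A\<^esub>)"
  using assms ghost_mult_vertex[OF assms]
  by (simp add: path_proj_def elt_closed path_elt_closed[OF assms(2)] ghost_elt_closed[OF assms(2)]
      mult_zero mult_assoc)

text \<open>
  The projections \<open>\<alpha> \<alpha>*\<close> commute because two paths are either comparable as prefixes, and then one
  projection lies below the other, or orthogonal. Stripping the first arcs simultaneously avoids
  naming the common prefix.
\<close>

lemma path_proj_commute:
  assumes "awalk u \<alpha> w" "awalk u' \<beta> w'"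
  shows "path_proj u \<alpha> \<otimes>\<^bsub>A\<^esub> path_proj u' \<beta> = path_proj u' \<beta> \<otimes>\<^bsub>A\<^esub> path_proj u \<alpha>"
  using assms
proof (induction \<alpha> arbitrary: u u' \<beta>)
  case Nil
  then show ?case
    by (auto simp: awalk_simps path_proj_Nil vertex_mult_proj[OF _ Nil.prems(2)]
        proj_mult_vertex[OF _ Nil.prems(2)])
next
  case (Cons e \<alpha>)
  show ?case
  proof (cases \<beta>)
    case Nil
    with Cons.prems show ?thesis
      by (auto simp: awalk_Nil_iff path_proj_Nil vertex_mult_proj[OF _ Cons.prems(1)]
          proj_mult_vertex[OF _ Cons.prems(1)])
  next
    case (Cons f \<beta>')
    have e: "e \<in> arcs E" and \<alpha>: "awalk (head E e) \<alpha> w" using Cons.prems by (auto simp: awalk_simps)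
    have f: "f \<in> arcs E" and \<beta>': "awalk (head E f) \<beta>' w'"
      using Cons.prems Cons by (auto simp: awalk_simps)
    have product: "path_proj u1 (e1 # \<alpha>1) \<otimes>\<^bsub>A\<^esub> path_proj u2 (e2 # \<alpha>2) = (if e1 = e2 then
        s e1 \<otimes>\<^bsub>A\<^esub> ((path_proj (head E e1) \<alpha>1 \<otimes>\<^bsub>A\<^esub> path_proj (head E e2) \<alpha>2) \<otimes>\<^bsub>A\<^esub> t e2) else \<zero>\<^bsub>A\<^esub>)"
      if w1: "awalk u1 (e1 # \<alpha>1) w1" and w2: "awalk u2 (e2 # \<alpha>2) w2" for u1 e1 \<alpha>1 w1 u2 e2 \<alpha>2 w2
    proof -
      have e12: "e1 \<in> arcs E" "e2 \<in> arcs E" and w1': "awalk (head E e1) \<alpha>1 w1"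
        and w2': "awalk (head E e2) \<alpha>2 w2"
        using w1 w2 by (auto simp: awalk_simps)
      note cl = e12 elt_closed path_proj_closed[OF w1'] path_proj_closed[OF w2']
      have "path_proj u1 (e1 # \<alpha>1) \<otimes>\<^bsub>A\<^esub> path_proj u2 (e2 # \<alpha>2)
        = s e1 \<otimes>\<^bsub>A\<^esub> (path_proj (head E e1) \<alpha>1 \<otimes>\<^bsub>A\<^esub>
            ((t e1 \<otimes>\<^bsub>A\<^esub> s e2) \<otimes>\<^bsub>A\<^esub> (path_proj (head E e2) \<alpha>2 \<otimes>\<^bsub>A\<^esub> t e2)))"
        by (simp add: path_proj_Cons[OF w1] path_proj_Cons[OF w2] mult_assoc cl)
      also have "\<dots> = (if e1 = e2 then
          s e1 \<otimes>\<^bsub>A\<^esub> (path_proj (head E e1) \<alpha>1 \<otimes>\<^bsub>A\<^esub>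
            ((p (head E e2) \<otimes>\<^bsub>A\<^esub> path_proj (head E e2) \<alpha>2) \<otimes>\<^bsub>A\<^esub> t e2)) else \<zero>\<^bsub>A\<^esub>)"
        by (simp add: t_s cl zero_mult mult_zero mult_assoc)
      finally show ?thesis
        using w1' by (cases "e1 = e2") (simp_all add: vertex_mult_proj[OF _ w2'] cl mult_assoc path_proj_closed)
    qed
    show ?thesis
      using Cons.prems Cons product[of u e \<alpha> w u' f \<beta>' w'] product[of u' f \<beta>' w' u e \<alpha> w]
        Cons.IH[OF \<alpha> \<beta>'] by auto
  qed
qed

lemma path_proj_mult_path:
  assumes "awalk u \<alpha> w"
  shows "path_proj u \<alpha> \<otimes>\<^bsub>A\<^esub> path_elt u \<alpha> = path_elt u \<alpha>"
  using ghost_path_elt[OF assms] path_elt_vertex[OF assms] assms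
  by (simp add: path_proj_def mult_assoc elt_closed path_elt_closed[OF assms] ghost_elt_closed[OF assms])

section \<open>Ghosts separate the elements of a principal left ideal\<close>

text \<open>
  The \<open>R\<close>-span of the monomials \<open>\<alpha> \<beta>*\<close> in which \<open>\<beta>\<close> starts at \<open>v\<close>, so that all of them lie in
  \<open>A (p v)\<close>. Closure under negation comes with the scalars.
\<close>

inductive_set monomial_span :: "'v \<Rightarrow> 'a set" for v where
  zero: "\<zero>\<^bsub>A\<^esub> \<in> monomial_span v"
| add: "x \<in> monomial_span v \<Longrightarrow> y \<in> monomial_span v \<Longrightarrow> x \<oplus>\<^bsub>A\<^esub> y \<in> monomial_span v"
| monomial: "r \<in> carrier R \<Longrightarrow> awalk u \<alpha> w \<Longrightarrow> awalk v \<beta> w \<Longrightarrow>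
    r \<odot>\<^bsub>A\<^esub> (path_elt u \<alpha> \<otimes>\<^bsub>A\<^esub> ghost_elt v \<beta>) \<in> monomial_span v"

lemma monomial_span_closed: "x \<in> monomial_span v \<Longrightarrow> x \<in> carrier A"
  by (induction rule: monomial_span.induct) (auto simp: elt_closed)

lemma monomial_span_smult:
  assumes "x \<in> monomial_span v" "r \<in> carrier R"
  shows "r \<odot>\<^bsub>A\<^esub> x \<in> monomial_span v"
  using assms
proof induction
  case (add x y)
  then show ?case by (simp add: smult_r_distr monomial_span_closed monomial_span.add)
next
  case (monomial r' u \<alpha> w \<beta>)
  then show ?case
    using monomial_span.monomial[of "r \<otimes>\<^bsub>R\<^esub> r'" u \<alpha> w v \<beta>] 
    by (simp add: smult_assoc1 elt_closed)
qed (simp_all add: monomial_span.zero)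

text \<open>
  Prepending an arc lengthens \<open>\<alpha>\<close>; a ghost arc either cancels the first arc of \<open>\<alpha>\<close> or, if \<open>\<alpha>\<close> is
  empty, is absorbed at the end of \<open>\<beta>\<close>.
\<close>

lemma monomial_span_mult_generator:
  assumes "x \<in> monomial_span v" "g \<in> p ` verts E \<union> s ` arcs E \<union> t ` arcs E"
  shows "g \<otimes>\<^bsub>A\<^esub> x \<in> monomial_span v"
  using assms
proof induction
  case zero
  then show ?case by (auto simp: mult_zero elt_closed monomial_span.zero)
next
  case (add x y)
  then have "g \<in> carrier A" by (auto simp: elt_closed)
  with add show ?case by (simp add: distr_left monomial_span_closed monomial_span.add)
next
  case (monomial r u \<alpha> w \<beta>)
  then have g: "g \<in> carrier A" by (auto simp: elt_closed)
  note cl = elt_closed path_elt_closed[OF \<open>awalk u \<alpha> w\<close>] ghost_elt_closed[OF \<open>awalk v \<beta> w\<close>]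
  have "g \<otimes>\<^bsub>A\<^esub> path_elt u \<alpha> \<otimes>\<^bsub>A\<^esub> ghost_elt v \<beta> \<in> monomial_span v"
  proof -
    have mono: "path_elt u' \<alpha>' \<otimes>\<^bsub>A\<^esub> ghost_elt v \<beta>' \<in> monomial_span v"
      if "awalk u' \<alpha>' w'" "awalk v \<beta>' w'" for u' \<alpha>' w' \<beta>'
      using monomial_span.monomial[OF R.one_closed that] that by (simp add: elt_closed)
    have z: "\<zero>\<^bsub>A\<^esub> \<otimes>\<^bsub>A\<^esub> ghost_elt v \<beta> \<in> monomial_span v"
      by (simp add: zero_mult cl monomial_span.zero)
    consider (vertex) a where "a \<in> verts E" "g = p a" | (edge) e where "e \<in> arcs E" "g = s e"
      | (ghost) e where "e \<in> arcs E" "g = t e"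
      using monomial.prems by auto
    then show ?thesis
    proof cases
      case vertex
      then show ?thesis using monomial z mono by (simp add: vertex_mult_path)
    next
      case edge
      then show ?thesis
        using monomial z mono[of "tail E e" "e # \<alpha>" w \<beta>]
        by (auto simp: edge_mult_path awalk_simps simp del: path_elt.simps)
    next
      case ghost
      show ?thesis
      proof (cases \<alpha>)
        case Nil
        then have w: "w = u" "u \<in> verts E" using monomial by (auto simp: awalk_simps)
        have "g \<otimes>\<^bsub>A\<^esub> path_elt u \<alpha> \<otimes>\<^bsub>A\<^esub> ghost_elt v \<beta> = g \<otimes>\<^bsub>A\<^esub> ghost_elt v \<beta>"
          using Nil w g vertex_ghost_elt[OF monomial(3)] by (simp add: mult_assoc cl)
        also have "\<dots> = (if tail E e = w then ghost_elt v (\<beta> @ [e]) else \<zero>\<^bsub>A\<^esub>)"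
          using ghost monomial by (simp add: ghost_edge_mult_ghost)
        also have "\<dots> \<in> monomial_span v"
        proof (cases "tail E e = w")
          case True
          then have be: "awalk v (\<beta> @ [e]) (head E e)"
            using ghost monomial by (auto simp: awalk_simps)
          have "path_elt (head E e) [] \<otimes>\<^bsub>A\<^esub> ghost_elt v (\<beta> @ [e]) \<in> monomial_span v"
            by (rule mono[OF _ be]) (use ghost in \<open>simp add: awalk_Nil_iff\<close>)
          with True show ?thesis using vertex_ghost_elt[OF be] by simp
        qed (simp add: monomial_span.zero)
        finally show ?thesis .
      next
        case (Cons f \<alpha>')
        then have "awalk (head E f) \<alpha>' w" using monomial by (simp add: awalk_simps)
        then show ?thesis
          using Cons ghost monomial z mono ghost_edge_mult_path[of e u f \<alpha>' w]
          by (simp del: path_elt.simps)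
      qed
    qed
  qed
  then show ?case
    using monomial g monomial_span_smult by (simp add: smult_mult_right cl flip: mult_assoc)
qed

text \<open>
  Multiplication by the product of the factors \<open>1 - \<alpha> \<alpha>*\<close> over a list of paths. Since there need not
  be a unit, it is written as iterated subtraction.
\<close>

primrec peel :: "('v \<times> 'e list) list \<Rightarrow> 'a \<Rightarrow> 'a" where
  "peel [] x = x"
| "peel (q # l) x = peel l (x \<ominus>\<^bsub>A\<^esub> path_proj (fst q) (snd q) \<otimes>\<^bsub>A\<^esub> x)"

definition walks :: "('v \<times> 'e list) set" where
  "walks = {(u, \<alpha>). \<exists>w. awalk u \<alpha> w}"

lemma walks_proj_closed: "q \<in> walks \<Longrightarrow> path_proj (fst q) (snd q) \<in> carrier A"
  by (auto simp: walks_def path_proj_closed)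

lemma peel_closed: "set l \<subseteq> walks \<Longrightarrow> x \<in> carrier A \<Longrightarrow> peel l x \<in> carrier A"
  by (induction l arbitrary: x) (auto simp: mult_closed walks_proj_closed)

lemma peel_add:
  "set l \<subseteq> walks \<Longrightarrow> x \<in> carrier A \<Longrightarrow> y \<in> carrier A \<Longrightarrow> peel l (x \<oplus>\<^bsub>A\<^esub> y) = peel l x \<oplus>\<^bsub>A\<^esub> peel l y"
proof (induction l arbitrary: x y)
  case (Cons q l)
  let ?P = "path_proj (fst q) (snd q)"
  have "x \<oplus>\<^bsub>A\<^esub> y \<ominus>\<^bsub>A\<^esub> ?P \<otimes>\<^bsub>A\<^esub> (x \<oplus>\<^bsub>A\<^esub> y) = (x \<ominus>\<^bsub>A\<^esub> ?P \<otimes>\<^bsub>A\<^esub> x) \<oplus>\<^bsub>A\<^esub> (y \<ominus>\<^bsub>A\<^esub> ?P \<otimes>\<^bsub>A\<^esub> y)"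
    using Cons.prems
    by (simp add: distr_left walks_proj_closed mult_closed M.minus_eq M.minus_add M.a_ac)
  with Cons show ?case by (simp add: mult_closed walks_proj_closed)
qed simp

lemma peel_append: "peel (l @ l') x = peel l' (peel l x)"
  by (induction l arbitrary: x) auto

lemma peel_single_commute:
  assumes "q \<in> walks" "set l \<subseteq> walks" "x \<in> carrier A"
  shows "peel [q] (peel l x) = peel l (peel [q] x)"
  using assms(2,3)
proof (induction l arbitrary: x)
  case (Cons q' l)
  let ?P = "path_proj (fst q) (snd q)" and ?Q = "path_proj (fst q') (snd q')"
  have cl: "?P \<in> carrier A" "?Q \<in> carrier A" using assms Cons.prems by (auto simp: walks_proj_closed)
  have PQ: "?P \<otimes>\<^bsub>A\<^esub> (?Q \<otimes>\<^bsub>A\<^esub> x) = ?Q \<otimes>\<^bsub>A\<^esub> (?P \<otimes>\<^bsub>A\<^esub> x)"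
    using assms Cons.prems cl path_proj_commute by (auto simp: walks_def simp flip: mult_assoc)
  have "peel [q] (peel [q'] x) = peel [q'] (peel [q] x)"
    using cl Cons.prems PQ
    by (simp add: mult_minus_right mult_closed)
       (simp add: M.minus_eq M.minus_add M.minus_minus mult_closed M.a_ac)
  moreover have "peel [q] (peel l (peel [q'] x)) = peel l (peel [q] (peel [q'] x))"
    using Cons cl by (intro Cons.IH) (auto simp: mult_closed)
  ultimately show ?case by simp
qed simp

lemma peel_zero: "set l \<subseteq> walks \<Longrightarrow> peel l \<zero>\<^bsub>A\<^esub> = \<zero>\<^bsub>A\<^esub>"
  by (induction l) (auto simp: mult_zero walks_proj_closed M.minus_eq a_inv_eq_smult)

lemma peel_commute:
  assumes "set l \<subseteq> walks" "set l' \<subseteq> walks" "x \<in> carrier A"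
  shows "peel l (peel l' x) = peel l' (peel l x)"
  using assms
proof (induction l arbitrary: x)
  case (Cons q l)
  have "peel (q # l) (peel l' x) = peel l (peel [q] (peel l' x))" by simp
  also have "\<dots> = peel l (peel l' (peel [q] x))"
    using Cons.prems by (subst peel_single_commute) auto
  also have "\<dots> = peel l' (peel l (peel [q] x))"
    using Cons.prems by (intro Cons.IH) (auto simp: mult_closed walks_proj_closed)
  finally show ?case by simp
qed simp

definition walks_into_tree :: "'v \<Rightarrow> ('v \<times> 'e list) set" where
  "walks_into_tree v = {(u, \<alpha>). \<exists>w \<beta>. awalk u \<alpha> w \<and> awalk v \<beta> w}"

lemma walks_into_tree_subset: "walks_into_tree v \<subseteq> walks"
  by (auto simp: walks_into_tree_def walks_def)

text \<open>
  A monomial \<open>\<alpha> \<beta>*\<close> is killed by \<open>1 - \<alpha> \<alpha>*\<close>. A sum is killed by the factors for both summands, as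
  these factors commute.
\<close>

lemma monomial_span_peel:
  assumes "x \<in> monomial_span v"
  shows "\<exists>l. set l \<subseteq> walks_into_tree v \<and> peel l x = \<zero>\<^bsub>A\<^esub>"
  using assms
proof induction
  case zero
  show ?case by (rule exI[of _ "[]"]) simp
next
  case (add x y)
  then obtain l l' where l: "set l \<subseteq> walks_into_tree v" "peel l x = \<zero>\<^bsub>A\<^esub>"
    and l': "set l' \<subseteq> walks_into_tree v" "peel l' y = \<zero>\<^bsub>A\<^esub>" by auto
  have w: "set l \<subseteq> walks" "set l' \<subseteq> walks" using l l' walks_into_tree_subset by auto
  have cl: "x \<in> carrier A" "y \<in> carrier A" using add by (auto simp: monomial_span_closed)
  have "peel (l @ l') (x \<oplus>\<^bsub>A\<^esub> y) = peel l' (peel l x) \<oplus>\<^bsub>A\<^esub> peel l (peel l' y)"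
    using w cl by (simp add: peel_append peel_add peel_closed peel_commute)
  also have "\<dots> = \<zero>\<^bsub>A\<^esub>" using l l' w by (simp add: peel_zero)
  finally show ?case using l l' by (intro exI[of _ "l @ l'"]) simp
next
  case (monomial r u \<alpha> w \<beta>)
  note cl = path_elt_closed[OF monomial(2)] ghost_elt_closed[OF monomial(3)]
    path_proj_closed[OF monomial(2)]
  have "path_proj u \<alpha> \<otimes>\<^bsub>A\<^esub> (r \<odot>\<^bsub>A\<^esub> (path_elt u \<alpha> \<otimes>\<^bsub>A\<^esub> ghost_elt v \<beta>))
      = r \<odot>\<^bsub>A\<^esub> ((path_proj u \<alpha> \<otimes>\<^bsub>A\<^esub> path_elt u \<alpha>) \<otimes>\<^bsub>A\<^esub> ghost_elt v \<beta>)"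
    using monomial cl by (simp add: smult_mult_right mult_closed mult_assoc)
  then have "peel [(u, \<alpha>)] (r \<odot>\<^bsub>A\<^esub> (path_elt u \<alpha> \<otimes>\<^bsub>A\<^esub> ghost_elt v \<beta>)) = \<zero>\<^bsub>A\<^esub>"
    using monomial cl path_proj_mult_path[OF monomial(2)]
    by (simp add: mult_closed M.minus_eq M.r_neg)
  then show ?case
    using monomial by (intro exI[of _ "[(u, \<alpha>)]"]) (auto simp: walks_into_tree_def)
qed

text \<open>
  If all the ghosts \<open>\<alpha>*\<close> annihilated \<open>x\<close>, then peeling would leave \<open>x\<close> unchanged, although some list
  of paths peels \<open>x\<close> down to \<open>0\<close>.
\<close>

lemma ghost_separates:
  assumes x: "x \<in> monomial_span v" "x \<noteq> \<zero>\<^bsub>A\<^esub>"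
  obtains u \<alpha> w \<beta> where "awalk u \<alpha> w" "awalk v \<beta> w" "ghost_elt u \<alpha> \<otimes>\<^bsub>A\<^esub> x \<noteq> \<zero>\<^bsub>A\<^esub>"
proof (rule ccontr)
  assume "\<not> thesis"
  with that have zero: "ghost_elt u \<alpha> \<otimes>\<^bsub>A\<^esub> x = \<zero>\<^bsub>A\<^esub>" if "awalk u \<alpha> w" "awalk v \<beta> w" for u \<alpha> w \<beta>
    using \<open>awalk u \<alpha> w\<close> \<open>awalk v \<beta> w\<close> by blast
  have cl: "x \<in> carrier A" using x by (simp add: monomial_span_closed)
  have "path_proj (fst q) (snd q) \<otimes>\<^bsub>A\<^esub> x = \<zero>\<^bsub>A\<^esub>" if "q \<in> walks_into_tree v" for q
    using that zero cl
    by (auto simp: walks_into_tree_def path_proj_def mult_assoc elt_closed mult_zero)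
  then have "peel l x = x" if "set l \<subseteq> walks_into_tree v" for l
    using that cl by (induction l) (auto simp: M.minus_eq a_inv_eq_smult)
  with monomial_span_peel[OF x(1)] x(2) show False by auto
qed

end

section \<open>Opposite algebras and minimal ideals\<close>

definition opposite :: "('r, 'a, 'y) module_scheme \<Rightarrow> ('r, 'a, 'y) module_scheme" where
  "opposite A = A\<lparr>mult := \<lambda>x y. y \<otimes>\<^bsub>A\<^esub> x\<rparr>"

lemma opposite_simps [simp]:
  "carrier (opposite A) = carrier A" "\<zero>\<^bsub>opposite A\<^esub> = \<zero>\<^bsub>A\<^esub>"
  "(\<oplus>\<^bsub>opposite A\<^esub>) = (\<oplus>\<^bsub>A\<^esub>)" "x \<otimes>\<^bsub>opposite A\<^esub> y = y \<otimes>\<^bsub>A\<^esub> x"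
  "r \<odot>\<^bsub>opposite A\<^esub> x = r \<odot>\<^bsub>A\<^esub> x"
  by (simp_all add: opposite_def)

lemma finsum_opposite [simp]: "finsum (opposite A) f I = finsum A f I"
  by (simp add: finsum_def)

lemma (in nonunital_algebra) opposite_algebra: "nonunital_algebra R (opposite A)"
proof -
  have "abelian_group (opposite A)"
    using M.abelian_group_axioms
    by (simp add: abelian_group_def abelian_monoid_def abelian_group_axioms_def)
  then have "Module.module R (opposite A)"
    by (intro moduleI R.cring_axioms)
      (simp_all add: smult_l_distr smult_r_distr smult_assoc1)
  then show ?thesis
    by (intro nonunital_algebra.intro nonunital_algebra_axioms.intro)
      (simp_all add: mult_closed mult_assoc distr_left distr_right smult_mult_left smult_mult_right)
qed

lemma (in leavitt_family) opposite_family: "leavitt_family R (opposite A) E p t s"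
  by (intro leavitt_family.intro leavitt_family_axioms.intro opposite_algebra wf_digraph_axioms)
    (auto simp: p_closed s_closed t_closed p_mult p_s s_p p_t t_p t_s p_sum)

lemma left_ideal_opposite: "left_ideal I (opposite A) \<longleftrightarrow> right_ideal I A"
  by (simp add: left_ideal_def right_ideal_def additive_subgroup_def)

lemma minimal_left_ideal_opposite: "minimal_left_ideal I (opposite A) \<longleftrightarrow> minimal_right_ideal I A"
  by (simp add: minimal_left_ideal_def minimal_right_ideal_def left_ideal_opposite)

lemma left_ideal_subset: "left_ideal I A \<Longrightarrow> I \<subseteq> carrier A"
  by (simp add: left_ideal_def additive_subgroup.a_subset)

lemma left_ideal_image:
  assumes A: "nonunital_algebra R A" and B: "nonunital_algebra R B"
    and h: "algebra_hom R A B h" and surj: "h ` carrier A = carrier B" and I: "left_ideal I A"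
  shows "left_ideal (h ` I) B"
proof -
  interpret A: nonunital_algebra R A by (rule A)
  interpret B: nonunital_algebra R B by (rule B)
  have hom: "group_hom (add_monoid A) (add_monoid B) h"
    using h by (intro group_hom.intro group_hom_axioms.intro A.M.a_group B.M.a_group)
      (auto simp: algebra_hom_def hom_def)
  have "additive_subgroup (h ` I) B"
    using I group_hom.subgroup_img_is_subgroup[OF hom]
    by (simp add: left_ideal_def additive_subgroup_def)
  moreover have "y \<otimes>\<^bsub>B\<^esub> h a \<in> h ` I" if y: "y \<in> carrier B" and a: "a \<in> I" for y a
  proof -
    obtain x where x: "x \<in> carrier A" "y = h x" using y surj by auto
    have "a \<in> carrier A" using a left_ideal_subset[OF I] by auto
    then have "y \<otimes>\<^bsub>B\<^esub> h a = h (x \<otimes>\<^bsub>A\<^esub> a)" using h x by (simp add: algebra_hom_def)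
    then show ?thesis using x a I by (auto simp: left_ideal_def)
  qed
  ultimately show ?thesis by (auto simp: left_ideal_def)
qed

lemma minimal_left_ideal_image:
  assumes A: "nonunital_algebra R A" and B: "nonunital_algebra R B"
    and h: "algebra_hom R A B h" and k: "algebra_hom R B A k"
    and kh: "\<And>x. x \<in> carrier A \<Longrightarrow> k (h x) = x" and hk: "\<And>y. y \<in> carrier B \<Longrightarrow> h (k y) = y"
    and I: "minimal_left_ideal I A"
  shows "minimal_left_ideal (h ` I) B"
proof -
  interpret A: nonunital_algebra R A by (rule A)
  interpret B: nonunital_algebra R B by (rule B)
  have hc: "h x \<in> carrier B" if "x \<in> carrier A" for x using h that by (auto simp: algebra_hom_def)
  have kc: "k x \<in> carrier A" if "x \<in> carrier B" for x using k that by (auto simp: algebra_hom_def)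
  have sh: "h ` carrier A = carrier B" using hc kc hk by (auto simp: image_iff) metis
  have sk: "k ` carrier B = carrier A" using hc kc kh by (auto simp: image_iff) metis
  have l: "left_ideal I A" and nz: "I \<noteq> {\<zero>\<^bsub>A\<^esub>}" using I by (auto simp: minimal_left_ideal_def)
  have k0: "k \<zero>\<^bsub>B\<^esub> = \<zero>\<^bsub>A\<^esub>"
  proof -
    have "k (\<zero>\<^bsub>R\<^esub> \<odot>\<^bsub>B\<^esub> \<zero>\<^bsub>B\<^esub>) = \<zero>\<^bsub>R\<^esub> \<odot>\<^bsub>A\<^esub> k \<zero>\<^bsub>B\<^esub>"
      using k A.R.zero_closed B.M.zero_closed unfolding algebra_hom_def by blast
    then show ?thesis using kc by simp
  qed
  have khI: "k ` h ` J = J" if "J \<subseteq> carrier A" for J using that kh by force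
  have hkJ: "h ` k ` J = J" if "J \<subseteq> carrier B" for J using that hk by force
  show ?thesis
    unfolding minimal_left_ideal_def
  proof (intro conjI allI impI)
    show "left_ideal (h ` I) B" by (rule left_ideal_image[OF A B h sh l])
    show "h ` I \<noteq> {\<zero>\<^bsub>B\<^esub>}" using khI[OF left_ideal_subset[OF l]] nz k0 by auto
    fix J assume "left_ideal J B \<and> J \<noteq> {\<zero>\<^bsub>B\<^esub>} \<and> J \<subseteq> h ` I"
    then have J: "left_ideal J B" "J \<noteq> {\<zero>\<^bsub>B\<^esub>}" "J \<subseteq> h ` I" by auto
    have "left_ideal (k ` J) A" by (rule left_ideal_image[OF B A k sk J(1)])
    moreover have "k ` J \<noteq> {\<zero>\<^bsub>A\<^esub>}"
    proof
      assume "k ` J = {\<zero>\<^bsub>A\<^esub>}"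
      then have "J = {h (k \<zero>\<^bsub>B\<^esub>)}" using hkJ[OF left_ideal_subset[OF J(1)]] k0 by auto
      with J hk show False by simp
    qed
    moreover have "k ` J \<subseteq> I"
      using image_mono[OF J(3), of k] khI[OF left_ideal_subset[OF l]] by simp
    ultimately have "k ` J = I" using I by (auto simp: minimal_left_ideal_def)
    then show "J = h ` I" using hkJ[OF left_ideal_subset[OF J(1)]] by auto
  qed
qed

section \<open>The involution of the Leavitt path algebra\<close>

locale leavitt_graph = R: cring R + wf_digraph E
  for R :: "('r, 'x) ring_scheme" and E :: "('v, 'e) pre_digraph"
begin

abbreviation L where "L \<equiv> leavitt R E"
abbreviation V where "V \<equiv> lpa_vertex R E"

lemmas leavitt_context = R.cring_axioms wf_digraph_axioms

sublocale L: leavitt_family R L E V "lpa_edge R E" "lpa_ghost R E"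
  by (rule leavitt_family_leavitt[OF leavitt_context])

lemma lpa_class_Neg:
  assumes a: "a \<in> lpa_terms R E"
  shows "lpa_class R E (Neg a) = (\<ominus>\<^bsub>R\<^esub> \<one>\<^bsub>R\<^esub>) \<odot>\<^bsub>L\<^esub> lpa_class R E a"
proof -
  have "lpa_class R E (Neg a) \<oplus>\<^bsub>L\<^esub> lpa_class R E a = \<zero>\<^bsub>L\<^esub>"
    using a by (auto simp: leavitt_ops[OF leavitt_context] lpa_terms.intros intro!: lpa_class_eqI[OF leavitt_context] lpa_cong.Plus_Neg)
  then have "lpa_class R E (Neg a) = \<ominus>\<^bsub>L\<^esub> lpa_class R E a"
    using a by (intro L.M.minus_equality[symmetric]) (auto intro: lpa_class_closed[OF leavitt_context] lpa_terms.intros)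
  then show ?thesis using a by (simp add: L.a_inv_eq_smult lpa_class_closed[OF leavitt_context])
qed

lemma leavitt_induct [consumes 1, case_names vertex edge ghost zero add mult smult]:
  assumes "x \<in> carrier L"
    and vertex: "\<And>v. v \<in> verts E \<Longrightarrow> P (V v)"
    and edge: "\<And>e. e \<in> arcs E \<Longrightarrow> P (lpa_edge R E e)"
    and ghost: "\<And>e. e \<in> arcs E \<Longrightarrow> P (lpa_ghost R E e)"
    and zero: "P \<zero>\<^bsub>L\<^esub>"
    and add: "\<And>x y. x \<in> carrier L \<Longrightarrow> y \<in> carrier L \<Longrightarrow> P x \<Longrightarrow> P y \<Longrightarrow> P (x \<oplus>\<^bsub>L\<^esub> y)"
    and mult: "\<And>x y. x \<in> carrier L \<Longrightarrow> y \<in> carrier L \<Longrightarrow> P x \<Longrightarrow> P y \<Longrightarrow> P (x \<otimes>\<^bsub>L\<^esub> y)"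
    and smult: "\<And>r x. r \<in> carrier R \<Longrightarrow> x \<in> carrier L \<Longrightarrow> P x \<Longrightarrow> P (r \<odot>\<^bsub>L\<^esub> x)"
  shows "P x"
proof -
  note cl = lpa_class_closed[OF leavitt_context]
  obtain a where a: "a \<in> lpa_terms R E" "x = lpa_class R E a"
    using assms(1) by (rule leavitt_carrierE[OF leavitt_context])
  have "P (lpa_class R E a)"
    using a(1)
  proof induction
    case (Neg a)
    then show ?case by (simp add: lpa_class_Neg smult cl)
  qed (use vertex edge ghost zero add mult smult in \<open>auto simp: cl lpa_vertex_def lpa_edge_def
      lpa_ghost_def leavitt_zero[OF leavitt_context] simp flip: leavitt_add[OF leavitt_context] leavitt_mult[OF leavitt_context] leavitt_smult[OF leavitt_context]\<close>)
  with a show ?thesis by simp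
qed

text \<open>
  In the opposite algebra arcs and ghost arcs form a Leavitt family with exchanged roles, so the
  universal property yields the map; its square fixes the generators.
\<close>

lemma involution:
  obtains h where "algebra_hom R L (opposite L) h" "\<And>x. x \<in> carrier L \<Longrightarrow> h (h x) = x"
    "\<And>v. v \<in> verts E \<Longrightarrow> h (V v) = V v"
proof -
  interpret op: leavitt_family R "opposite L" E V "lpa_ghost R E" "lpa_edge R E"
    by (rule L.opposite_family)
  obtain h where h: "algebra_hom R L (opposite L) h" "\<And>v. v \<in> verts E \<Longrightarrow> h (V v) = V v"
    "\<And>e. e \<in> arcs E \<Longrightarrow> h (lpa_edge R E e) = lpa_ghost R E e"
    "\<And>e. e \<in> arcs E \<Longrightarrow> h (lpa_ghost R E e) = lpa_edge R E e"
    using op.leavitt_universal by blast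
  have hh: "algebra_hom R L L (\<lambda>x. h (h x))" and id: "algebra_hom R L L (\<lambda>x. x)"
    using h(1) by (auto simp: algebra_hom_def Pi_iff)
  have "h (h x) = x" if "x \<in> carrier L" for x
    by (rule L.leavitt_universal_unique[OF hh id _ _ _ that]) (simp_all add: h)
  with h that show thesis by blast
qed

lemma minimal_left_iff_minimal_right:
  assumes v: "v \<in> verts E"
  shows "minimal_left_ideal {x \<otimes>\<^bsub>L\<^esub> V v | x. x \<in> carrier L} L \<longleftrightarrow>
    minimal_right_ideal {V v \<otimes>\<^bsub>L\<^esub> x | x. x \<in> carrier L} L"
proof -
  obtain h where h: "algebra_hom R L (opposite L) h" and hh: "\<And>x. x \<in> carrier L \<Longrightarrow> h (h x) = x"
    and hv: "h (V v) = V v"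
    using involution v by metis
  have h': "algebra_hom R (opposite L) L h"
    using h by (auto simp: algebra_hom_def)
  let ?I = "{x \<otimes>\<^bsub>L\<^esub> V v | x. x \<in> carrier L}" and ?J = "{V v \<otimes>\<^bsub>L\<^esub> x | x. x \<in> carrier L}"
  have hc: "h x \<in> carrier L" if "x \<in> carrier L" for x using h that by (auto simp: algebra_hom_def)
  have hm: "h (x \<otimes>\<^bsub>L\<^esub> y) = h y \<otimes>\<^bsub>L\<^esub> h x" if "x \<in> carrier L" "y \<in> carrier L" for x y
    using h that by (simp add: algebra_hom_def)
  have IJ: "h ` ?I \<subseteq> ?J" "h ` ?J \<subseteq> ?I"
    using hm hc hv L.p_closed[OF v] by auto
  have hhI: "h ` h ` K = K" if "K \<subseteq> carrier L" for K
    using hh[OF subsetD[OF that]] by (simp add: image_image cong: image_cong_simp)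
  have sub: "?I \<subseteq> carrier L" "?J \<subseteq> carrier L" using L.p_closed[OF v] L.mult_closed by auto
  have eq: "h ` ?I = ?J" "h ` ?J = ?I"
    using IJ image_mono[OF IJ(1), of h] image_mono[OF IJ(2), of h] hhI[OF sub(1)] hhI[OF sub(2)]
    by simp_all
  note img = minimal_left_ideal_image[of R]
  have "minimal_left_ideal ?I L \<Longrightarrow> minimal_left_ideal (h ` ?I) (opposite L)"
    by (rule img[OF L.nonunital_algebra_axioms L.opposite_algebra h h']) (simp_all add: hh)
  moreover have "minimal_left_ideal ?J (opposite L) \<Longrightarrow> minimal_left_ideal (h ` ?J) L"
    by (rule img[OF L.opposite_algebra L.nonunital_algebra_axioms h' h]) (simp_all add: hh)
  ultimately show ?thesis unfolding eq minimal_left_ideal_opposite by blast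
qed

section \<open>A criterion for minimality\<close>

lemma vertex_in_span:
  assumes "v \<in> verts E"
  shows "V v \<in> L.monomial_span v"
proof -
  have "\<one>\<^bsub>R\<^esub> \<odot>\<^bsub>L\<^esub> (L.path_elt v [] \<otimes>\<^bsub>L\<^esub> L.ghost_elt v []) \<in> L.monomial_span v"
    using assms by (intro L.monomial_span.monomial[of _ v "[]" v]) (auto simp: awalk_Nil_iff)
  then show ?thesis using assms by (simp add: L.p_mult L.p_closed)
qed

lemma span_left_ideal:
  assumes "x \<in> carrier L" "y \<in> L.monomial_span v"
  shows "x \<otimes>\<^bsub>L\<^esub> y \<in> L.monomial_span v"
  using assms
proof (induction x arbitrary: y rule: leavitt_induct)
  case (mult x z)
  then show ?case by (simp add: L.mult_assoc L.monomial_span_closed)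
qed (simp_all add: L.monomial_span_mult_generator L.zero_mult L.monomial_span_closed
    L.monomial_span.zero L.distr_right L.monomial_span.add L.smult_mult_left L.monomial_span_smult)

lemma mult_vertex_in_span:
  "v \<in> verts E \<Longrightarrow> x \<in> carrier L \<Longrightarrow> x \<otimes>\<^bsub>L\<^esub> V v \<in> L.monomial_span v"
  by (intro span_left_ideal vertex_in_span)

lemma left_multiples_left_ideal:
  assumes x: "x \<in> carrier L"
  shows "left_ideal {y \<otimes>\<^bsub>L\<^esub> x | y. y \<in> carrier L} L" (is "left_ideal ?J L")
proof -
  have "subgroup ?J (add_monoid L)"
  proof (rule L.M.add.subgroupI)
    show "?J \<subseteq> carrier L" using x L.mult_closed by auto
    show "?J \<noteq> {}" by blast
    fix a assume "a \<in> ?J"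
    then obtain y where y: "y \<in> carrier L" "a = y \<otimes>\<^bsub>L\<^esub> x" by auto
    then have "\<ominus>\<^bsub>L\<^esub> a = (\<ominus>\<^bsub>L\<^esub> y) \<otimes>\<^bsub>L\<^esub> x"
      using x by (simp add: L.a_inv_eq_smult L.smult_mult_left L.mult_closed)
    with y show "\<ominus>\<^bsub>L\<^esub> a \<in> ?J" by blast
    fix b assume "b \<in> ?J"
    then obtain z where z: "z \<in> carrier L" "b = z \<otimes>\<^bsub>L\<^esub> x" by auto
    with y x have "a \<oplus>\<^bsub>L\<^esub> b = (y \<oplus>\<^bsub>L\<^esub> z) \<otimes>\<^bsub>L\<^esub> x" by (simp add: L.distr_right)
    with y z show "a \<oplus>\<^bsub>L\<^esub> b \<in> ?J" by blast
  qed
  moreover have "z \<otimes>\<^bsub>L\<^esub> (y \<otimes>\<^bsub>L\<^esub> x) \<in> ?J" if "z \<in> carrier L" "y \<in> carrier L" for z y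
    using that x L.mult_closed by (auto simp: L.mult_assoc[symmetric])
  ultimately show ?thesis by (auto simp: left_ideal_def additive_subgroup_def)
qed

text \<open>
  For a nonzero \<open>x\<close> in \<open>L v\<close> the ideal \<open>L x\<close> is nonzero because some ghost does not annihilate \<open>x\<close>. This
  replaces the equation \<open>x = 1 x\<close>, which is not at hand without a unit.
\<close>

lemma minimal_left_ideal_iff:
  assumes v: "v \<in> verts E"
  shows "minimal_left_ideal {x \<otimes>\<^bsub>L\<^esub> V v | x. x \<in> carrier L} L \<longleftrightarrow> V v \<noteq> \<zero>\<^bsub>L\<^esub> \<and>
    (\<forall>x\<in>carrier L. x \<otimes>\<^bsub>L\<^esub> V v = x \<and> x \<noteq> \<zero>\<^bsub>L\<^esub> \<longrightarrow> (\<exists>y\<in>carrier L. y \<otimes>\<^bsub>L\<^esub> x = V v))"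
    (is "minimal_left_ideal ?I L \<longleftrightarrow> _")
proof -
  have vc: "V v \<in> carrier L" and vv: "V v \<otimes>\<^bsub>L\<^esub> V v = V v"
    using v by (simp_all add: L.p_closed L.p_mult)
  have vI: "V v \<in> ?I" using vc vv by force
  have I: "x \<in> ?I \<longleftrightarrow> x \<in> carrier L \<and> x \<otimes>\<^bsub>L\<^esub> V v = x" for x
    using vc vv by (auto simp: L.mult_assoc L.mult_closed)
  show ?thesis
  proof (intro iffI conjI ballI impI)
    assume min: "minimal_left_ideal ?I L"
    show "V v \<noteq> \<zero>\<^bsub>L\<^esub>"
    proof
      assume "V v = \<zero>\<^bsub>L\<^esub>"
      then have "x \<otimes>\<^bsub>L\<^esub> V v = \<zero>\<^bsub>L\<^esub>" if "x \<in> carrier L" for x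
        using that L.mult_zero by simp
      with vc have "?I = {\<zero>\<^bsub>L\<^esub>}" by blast
      with min show False by (simp add: minimal_left_ideal_def)
    qed
    fix x assume x: "x \<in> carrier L" "x \<otimes>\<^bsub>L\<^esub> V v = x \<and> x \<noteq> \<zero>\<^bsub>L\<^esub>"
    let ?J = "{y \<otimes>\<^bsub>L\<^esub> x | y. y \<in> carrier L}"
    have "x \<in> L.monomial_span v" using x mult_vertex_in_span[OF v, of x] by simp
    moreover have "x \<noteq> \<zero>\<^bsub>L\<^esub>" using x by simp
    ultimately obtain u \<alpha> w \<beta> where a: "awalk u \<alpha> w" "awalk v \<beta> w" "L.ghost_elt u \<alpha> \<otimes>\<^bsub>L\<^esub> x \<noteq> \<zero>\<^bsub>L\<^esub>"
      by (rule L.ghost_separates)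
    then have "?J \<noteq> {\<zero>\<^bsub>L\<^esub>}" using L.ghost_elt_closed[OF a(1)] by blast
    moreover have "?J \<subseteq> ?I"
    proof
      fix b assume "b \<in> ?J"
      then obtain y where y: "y \<in> carrier L" "b = y \<otimes>\<^bsub>L\<^esub> x" by blast
      have "b \<otimes>\<^bsub>L\<^esub> V v = y \<otimes>\<^bsub>L\<^esub> (x \<otimes>\<^bsub>L\<^esub> V v)"
        unfolding y(2) by (rule L.mult_assoc[OF y(1) x(1) vc])
      with x y L.mult_closed show "b \<in> ?I" unfolding I by simp
    qed
    ultimately have "?J = ?I"
      using min left_multiples_left_ideal[OF x(1)] by (auto simp: minimal_left_ideal_def)
    with vI have "V v \<in> ?J" by (simp only:)
    then show "\<exists>y\<in>carrier L. y \<otimes>\<^bsub>L\<^esub> x = V v" by force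
  next
    assume r: "V v \<noteq> \<zero>\<^bsub>L\<^esub> \<and>
      (\<forall>x\<in>carrier L. x \<otimes>\<^bsub>L\<^esub> V v = x \<and> x \<noteq> \<zero>\<^bsub>L\<^esub> \<longrightarrow> (\<exists>y\<in>carrier L. y \<otimes>\<^bsub>L\<^esub> x = V v))"
    have "J = ?I" if J: "left_ideal J L" "J \<noteq> {\<zero>\<^bsub>L\<^esub>}" "J \<subseteq> ?I" for J
    proof -
      have "\<zero>\<^bsub>L\<^esub> \<in> J" using J(1) by (simp add: left_ideal_def additive_subgroup.zero_closed)
      with J(2) obtain x where x: "x \<in> J" "x \<noteq> \<zero>\<^bsub>L\<^esub>" by auto
      then have "x \<in> carrier L" "x \<otimes>\<^bsub>L\<^esub> V v = x" using J(3) I by blast+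
      with r x(2) obtain y where y: "y \<in> carrier L" "y \<otimes>\<^bsub>L\<^esub> x = V v" by blast
      have absorb: "z \<otimes>\<^bsub>L\<^esub> a \<in> J" if "z \<in> carrier L" "a \<in> J" for z a
        using J(1) that by (simp add: left_ideal_def)
      have "V v \<in> J" using absorb[OF y(1) x(1)] by (simp only: y(2))
      with absorb have "?I \<subseteq> J" by blast
      with J(3) show ?thesis by (rule equalityI)
    qed
    moreover have "?I \<noteq> {\<zero>\<^bsub>L\<^esub>}" using vI conjunct1[OF r] by (metis singletonD)
    ultimately show "minimal_left_ideal ?I L"
      using left_multiples_left_ideal[OF vc] by (simp add: minimal_left_ideal_def)
  qed
qed

section \<open>The corner at a line point\<close>

lemma line_point_out_arc:
  assumes v: "v \<in> line_points E" and e: "e \<in> out_arcs E v"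
  shows "head E e \<in> line_points E" "out_arcs E v = {e}"
    "lpa_edge R E e \<otimes>\<^bsub>L\<^esub> lpa_ghost R E e = V v"
proof -
  have v': "v \<in> verts E" "\<And>w. w \<in> vertex_tree E v \<Longrightarrow> \<not> bifurcation E w \<and> \<not> closed_path_base E w"
    using v by (auto simp: line_points_def)
  have "vertex_tree E (head E e) \<subseteq> vertex_tree E v"
  proof
    fix w assume "w \<in> vertex_tree E (head E e)"
    then obtain q where "w \<in> verts E" "awalk (head E e) q w" by (auto simp: vertex_tree_def)
    with e have "w \<in> verts E" "awalk v (e # q) w" by (auto simp: awalk_simps)
    then show "w \<in> vertex_tree E v" by (auto simp: vertex_tree_def)
  qed
  with v e show "head E e \<in> line_points E" by (auto simp: line_points_def)
  have "v \<in> vertex_tree E v"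
    using v'(1) awalk_Nil_iff[of v v] by (auto simp: vertex_tree_def)
  with v'(2) e show o: "out_arcs E v = {e}" by (auto simp: bifurcation_def)
  have "V v = (\<Oplus>\<^bsub>L\<^esub>e\<in>{e}. lpa_edge R E e \<otimes>\<^bsub>L\<^esub> lpa_ghost R E e)"
    using L.p_sum[OF v'(1)] o by simp
  also have "\<dots> = lpa_edge R E e \<otimes>\<^bsub>L\<^esub> lpa_ghost R E e"
    using e by (subst L.M.finsum_insert) (auto simp: L.gen_closed)
  finally show "lpa_edge R E e \<otimes>\<^bsub>L\<^esub> lpa_ghost R E e = V v" by simp
qed

lemma line_point_proj: "v \<in> line_points E \<Longrightarrow> awalk v \<alpha> w \<Longrightarrow> L.path_proj v \<alpha> = V v"
proof (induction \<alpha> arbitrary: v)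
  case Nil
  then show ?case by (auto simp: awalk_Nil_iff L.path_proj_Nil)
next
  case (Cons e \<alpha>)
  then have e: "e \<in> out_arcs E v" "awalk (head E e) \<alpha> w" and "e \<in> arcs E"
    by (auto simp: awalk_simps)
  then show ?case
    using Cons.IH[of "head E e"] line_point_out_arc[OF Cons.prems(1) e(1)] L.path_proj_Cons[OF Cons.prems(2)]
    by (simp add: L.p_t)
qed

lemma line_point_no_closed:
  assumes "v \<in> line_points E" "awalk v \<alpha> v" shows "\<alpha> = []"
proof (rule ccontr)
  assume "\<alpha> \<noteq> []"
  then have "closed_path_base E v" using assms(2) by (auto simp: closed_path_base_def)
  moreover have "v \<in> vertex_tree E v" using assms by (auto simp: vertex_tree_def)
  ultimately show False using assms(1) by (auto simp: line_points_def)
qed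

lemma line_point_walk_unique:
  "v \<in> line_points E \<Longrightarrow> awalk v \<alpha> w \<Longrightarrow> awalk v \<beta> w \<Longrightarrow> \<alpha> = \<beta>"
proof (induction \<alpha> arbitrary: v \<beta>)
  case Nil
  then have "w = v" by (simp add: awalk_Nil_iff)
  with Nil show ?case using line_point_no_closed by auto
next
  case (Cons e \<alpha>)
  then have e: "e \<in> out_arcs E v" "awalk (head E e) \<alpha> w" by (auto simp: awalk_simps)
  show ?case
  proof (cases \<beta>)
    case Nil
    with Cons.prems have "w = v" by (simp add: awalk_Nil_iff)
    with Cons.prems line_point_no_closed show ?thesis by blast
  next
    case (Cons f \<beta>')
    with Cons.prems(3) have f: "f \<in> out_arcs E v" "awalk (head E f) \<beta>' w" by (auto simp: awalk_simps)
    then have "f = e" using line_point_out_arc(2)[OF Cons.prems(1) e(1)] by auto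
    with Cons.IH[OF line_point_out_arc(1)[OF Cons.prems(1) e(1)] e(2)] f Cons show ?thesis by simp
  qed
qed

text \<open>
  Multiplied by \<open>v\<close> from the left, a monomial \<open>\<alpha> \<beta>*\<close> survives only if \<open>\<alpha>\<close> also starts at \<open>v\<close>; then
  \<open>\<alpha> = \<beta>\<close> because both end at the same vertex, and \<open>\<alpha> \<alpha>* = v\<close>.
\<close>

lemma line_point_corner:
  assumes v: "v \<in> line_points E"
  shows "{V v \<otimes>\<^bsub>L\<^esub> x \<otimes>\<^bsub>L\<^esub> V v | x. x \<in> carrier L} = {r \<odot>\<^bsub>L\<^esub> V v | r. r \<in> carrier R}"
proof -
  have vE: "v \<in> verts E" using v by (simp add: line_points_def)
  have vc: "V v \<in> carrier L" and vv: "V v \<otimes>\<^bsub>L\<^esub> V v = V v"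
    using vE by (simp_all add: L.p_closed L.p_mult)
  have span: "\<exists>r\<in>carrier R. V v \<otimes>\<^bsub>L\<^esub> y = r \<odot>\<^bsub>L\<^esub> V v" if "y \<in> L.monomial_span v" for y
    using that
  proof induction
    case zero
    show ?case using vc by (intro bexI[of _ "\<zero>\<^bsub>R\<^esub>"]) (simp_all add: L.mult_zero)
  next
    case (add x y)
    then obtain r q where "r \<in> carrier R" "q \<in> carrier R" "V v \<otimes>\<^bsub>L\<^esub> x = r \<odot>\<^bsub>L\<^esub> V v" "V v \<otimes>\<^bsub>L\<^esub> y = q \<odot>\<^bsub>L\<^esub> V v"
      by auto
    with add vc show ?case
      by (intro bexI[of _ "r \<oplus>\<^bsub>R\<^esub> q"]) (simp_all add: L.distr_left L.smult_l_distr L.monomial_span_closed)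
  next
    case (monomial r u \<alpha> w \<beta>)
    note cl = L.path_elt_closed[OF monomial(2)] L.ghost_elt_closed[OF monomial(3)]
    have eq: "V v \<otimes>\<^bsub>L\<^esub> (r \<odot>\<^bsub>L\<^esub> (L.path_elt u \<alpha> \<otimes>\<^bsub>L\<^esub> L.ghost_elt v \<beta>))
        = r \<odot>\<^bsub>L\<^esub> ((if v = u then L.path_elt u \<alpha> else \<zero>\<^bsub>L\<^esub>) \<otimes>\<^bsub>L\<^esub> L.ghost_elt v \<beta>)"
      using monomial(1) cl vc L.vertex_mult_path[OF vE monomial(2)]
      by (simp add: L.smult_mult_right L.mult_closed flip: L.mult_assoc)
    show ?case
    proof (cases "v = u")
      case True
      then have "\<alpha> = \<beta>" using line_point_walk_unique[OF v] monomial by auto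
      with True eq line_point_proj[OF v monomial(3)] monomial(1) show ?thesis
        by (auto simp: L.path_proj_def)
    next
      case False
      with eq cl monomial(1) vc show ?thesis
        by (intro bexI[of _ "\<zero>\<^bsub>R\<^esub>"]) (simp_all add: L.zero_mult)
    qed
  qed
  show ?thesis
  proof (intro equalityI subsetI)
    fix z assume "z \<in> {V v \<otimes>\<^bsub>L\<^esub> x \<otimes>\<^bsub>L\<^esub> V v | x. x \<in> carrier L}"
    then obtain x where x: "x \<in> carrier L" "z = V v \<otimes>\<^bsub>L\<^esub> (x \<otimes>\<^bsub>L\<^esub> V v)"
      using vc by (auto simp: L.mult_assoc)
    with span[OF mult_vertex_in_span[OF vE x(1)]] show "z \<in> {r \<odot>\<^bsub>L\<^esub> V v | r. r \<in> carrier R}" by auto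
  next
    fix z assume "z \<in> {r \<odot>\<^bsub>L\<^esub> V v | r. r \<in> carrier R}"
    then obtain r where r: "r \<in> carrier R" "z = r \<odot>\<^bsub>L\<^esub> V v" by auto
    then have "z = V v \<otimes>\<^bsub>L\<^esub> (r \<odot>\<^bsub>L\<^esub> V v) \<otimes>\<^bsub>L\<^esub> V v"
      using vc vv by (simp add: L.smult_mult_right L.smult_mult_left)
    with r vc show "z \<in> {V v \<otimes>\<^bsub>L\<^esub> x \<otimes>\<^bsub>L\<^esub> V v | x. x \<in> carrier L}" by blast
  qed
qed

text \<open>
  The factor \<open>\<beta> \<alpha>*\<close>, called \<open>?c\<close> below, moves a nonzero \<open>\<alpha>* x\<close> into the corner at \<open>v\<close>. Nothing is lost,
  since \<open>\<beta>*\<close> moves it back.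
\<close>

lemma corner_imp_minimal:
  assumes v: "v \<in> verts E" and nz: "V v \<noteq> \<zero>\<^bsub>L\<^esub>" and "field R"
    and corner: "{V v \<otimes>\<^bsub>L\<^esub> x \<otimes>\<^bsub>L\<^esub> V v | x. x \<in> carrier L} = {r \<odot>\<^bsub>L\<^esub> V v | r. r \<in> carrier R}"
  shows "minimal_left_ideal {x \<otimes>\<^bsub>L\<^esub> V v | x. x \<in> carrier L} L"
proof -
  interpret F: field R by fact
  have vc: "V v \<in> carrier L" using v by (simp add: L.p_closed)
  have "\<exists>y\<in>carrier L. y \<otimes>\<^bsub>L\<^esub> x = V v"
    if x: "x \<in> carrier L" "x \<otimes>\<^bsub>L\<^esub> V v = x" "x \<noteq> \<zero>\<^bsub>L\<^esub>" for x
  proof -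
    have "x \<in> L.monomial_span v" using x mult_vertex_in_span[OF v, of x] by simp
    from this x(3) obtain u \<alpha> w \<beta> where a: "awalk u \<alpha> w" and b: "awalk v \<beta> w"
      and nz: "L.ghost_elt u \<alpha> \<otimes>\<^bsub>L\<^esub> x \<noteq> \<zero>\<^bsub>L\<^esub>"
      by (rule L.ghost_separates)
    note cl = x(1) vc L.mult_closed L.ghost_elt_closed[OF a] L.path_elt_closed[OF b] L.ghost_elt_closed[OF b]
    let ?c = "L.path_elt v \<beta> \<otimes>\<^bsub>L\<^esub> L.ghost_elt u \<alpha>"
    have w: "V w \<in> carrier L" using a L.p_closed by blast
    have "V v \<otimes>\<^bsub>L\<^esub> (?c \<otimes>\<^bsub>L\<^esub> x) \<otimes>\<^bsub>L\<^esub> V v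
        = (V v \<otimes>\<^bsub>L\<^esub> L.path_elt v \<beta>) \<otimes>\<^bsub>L\<^esub> L.ghost_elt u \<alpha> \<otimes>\<^bsub>L\<^esub> (x \<otimes>\<^bsub>L\<^esub> V v)"
      using cl by (simp add: L.mult_assoc)
    then have "?c \<otimes>\<^bsub>L\<^esub> x = V v \<otimes>\<^bsub>L\<^esub> (?c \<otimes>\<^bsub>L\<^esub> x) \<otimes>\<^bsub>L\<^esub> V v"
      by (simp only: L.vertex_path_elt[OF b] x(2))
    moreover have "?c \<otimes>\<^bsub>L\<^esub> x \<in> carrier L" using cl by simp
    ultimately obtain r where r: "r \<in> carrier R" "?c \<otimes>\<^bsub>L\<^esub> x = r \<odot>\<^bsub>L\<^esub> V v"
      using corner by blast
    have "L.ghost_elt v \<beta> \<otimes>\<^bsub>L\<^esub> (?c \<otimes>\<^bsub>L\<^esub> x)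
        = (L.ghost_elt v \<beta> \<otimes>\<^bsub>L\<^esub> L.path_elt v \<beta>) \<otimes>\<^bsub>L\<^esub> L.ghost_elt u \<alpha> \<otimes>\<^bsub>L\<^esub> x"
      using cl by (simp add: L.mult_assoc)
    also have "\<dots> = L.ghost_elt u \<alpha> \<otimes>\<^bsub>L\<^esub> x"
      using L.ghost_path_elt[OF b] L.vertex_ghost_elt[OF a] by simp
    finally have "?c \<otimes>\<^bsub>L\<^esub> x \<noteq> \<zero>\<^bsub>L\<^esub>" using nz cl by (auto simp: L.mult_zero)
    then have "r \<noteq> \<zero>\<^bsub>R\<^esub>" using r(2) vc by (metis L.smult_l_null)
    then have ir: "inv\<^bsub>R\<^esub> r \<in> carrier R" "inv\<^bsub>R\<^esub> r \<otimes>\<^bsub>R\<^esub> r = \<one>\<^bsub>R\<^esub>"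
      using r F.field_Units by auto
    have "(inv\<^bsub>R\<^esub> r \<odot>\<^bsub>L\<^esub> ?c) \<otimes>\<^bsub>L\<^esub> x = inv\<^bsub>R\<^esub> r \<odot>\<^bsub>L\<^esub> (?c \<otimes>\<^bsub>L\<^esub> x)"
      using ir cl by (simp add: L.smult_mult_left)
    also have "\<dots> = V v" using ir r vc by (simp flip: L.smult_assoc1)
    finally show ?thesis using ir cl by (intro bexI[of _ "inv\<^bsub>R\<^esub> r \<odot>\<^bsub>L\<^esub> ?c"]) simp_all
  qed
  with nz show ?thesis by (simp add: minimal_left_ideal_iff[OF v])
qed

end

section \<open>A graded representation\<close>

text \<open>
  Give every vertex \<open>u\<close> a copy of the natural numbers. If \<open>u\<close> emits arcs, then the pairs of an arc
  leaving \<open>u\<close> and a number are again countably infinite in number, so they can be coded bijectively by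
  the copy at \<open>u\<close>. Each arc thereby embeds the copy at its head into the copy at its tail, the images
  of distinct arcs are disjoint, and the images of all arcs leaving \<open>u\<close> fill the copy at \<open>u\<close>. This is
  what the Leavitt relations ask for. An additional integer coordinate, raised by one by each
  arc, separates paths of different lengths.
\<close>

locale countable_leavitt_graph = leavitt_graph R E
  for R :: "('r, 'x) ring_scheme" and E :: "('v, 'e) pre_digraph" +
  assumes countable_arcs: "countable (arcs E)"
begin

definition code :: "'e \<Rightarrow> nat \<Rightarrow> nat" where
  "code e n = to_nat_on (out_arcs E (tail E e) \<times> (UNIV :: nat set)) (e, n)"

definition decode :: "'v \<Rightarrow> nat \<Rightarrow> 'e \<times> nat" where
  "decode u n = from_nat_into (out_arcs E u \<times> (UNIV :: nat set)) n"

lemma countable_out_arcs: "countable (out_arcs E u \<times> (UNIV :: nat set))"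
proof -
  have "out_arcs E u \<subseteq> arcs E" by auto
  then show ?thesis using countable_arcs countable_subset by auto
qed

lemma decode_code: "e \<in> arcs E \<Longrightarrow> decode (tail E e) (code e n) = (e, n)"
  unfolding code_def decode_def by (rule from_nat_into_to_nat_on[OF countable_out_arcs]) auto

lemma code_decode:
  assumes "out_arcs E u \<noteq> {}"
  shows "fst (decode u n) \<in> out_arcs E u" "code (fst (decode u n)) (snd (decode u n)) = n"
proof -
  have inf: "infinite (out_arcs E u \<times> (UNIV :: nat set))"
    using assms by (simp add: finite_cartesian_product_iff)
  have "decode u n \<in> out_arcs E u \<times> UNIV"
    unfolding decode_def using assms by (intro from_nat_into) auto
  then show o: "fst (decode u n) \<in> out_arcs E u" by auto
  have "to_nat_on (out_arcs E u \<times> (UNIV :: nat set)) (decode u n) = n"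
    unfolding decode_def by (rule to_nat_on_from_nat_into_infinite[OF countable_out_arcs inf])
  with o show "code (fst (decode u n)) (snd (decode u n)) = n" by (auto simp: code_def)
qed

text \<open>
  The action on functions from the coded points to \<open>R\<close>. All functions are admitted, and not only the
  finitely supported ones, in order to have the constant function \<open>1\<close>.
\<close>

primrec act :: "('r, 'v, 'e) lpa_term \<Rightarrow> ('v \<times> nat \<times> int \<Rightarrow> 'r) \<Rightarrow> 'v \<times> nat \<times> int \<Rightarrow> 'r" where
  "act (Vtx w) m = (\<lambda>(u, n, k). if u = w then m (u, n, k) else \<zero>\<^bsub>R\<^esub>)"
| "act (Edge e) m = (\<lambda>(u, n, k). if u = tail E e \<and> fst (decode u n) = e
      then m (head E e, snd (decode u n), k - 1) else \<zero>\<^bsub>R\<^esub>)"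
| "act (Ghost e) m = (\<lambda>(u, n, k). if u = head E e then m (tail E e, code e n, k + 1) else \<zero>\<^bsub>R\<^esub>)"
| "act Zer m = (\<lambda>x. \<zero>\<^bsub>R\<^esub>)"
| "act (Plus a b) m = (\<lambda>x. act a m x \<oplus>\<^bsub>R\<^esub> act b m x)"
| "act (Neg a) m = (\<lambda>x. \<ominus>\<^bsub>R\<^esub> act a m x)"
| "act (Times a b) m = act a (act b m)"
| "act (Scale r a) m = (\<lambda>x. r \<otimes>\<^bsub>R\<^esub> act a m x)"

definition vectors :: "('v \<times> nat \<times> int \<Rightarrow> 'r) set" where
  "vectors = {m. \<forall>z. m z \<in> carrier R}"

lemma vectorsI: "(\<And>z. m z \<in> carrier R) \<Longrightarrow> m \<in> vectors"
  by (simp add: vectors_def)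

lemma vectorsD [simp]: "m \<in> vectors \<Longrightarrow> m z \<in> carrier R"
  unfolding vectors_def by blast

lemma vectors_const: "r \<in> carrier R \<Longrightarrow> (\<lambda>z. r) \<in> vectors"
  by (rule vectorsI) simp

lemma act_closed: "a \<in> lpa_terms R E \<Longrightarrow> m \<in> vectors \<Longrightarrow> act a m \<in> vectors"
  by (induction arbitrary: m rule: lpa_terms.induct) (auto intro!: vectorsI split: prod.split)

lemma act_add:
  assumes "a \<in> lpa_terms R E" "m \<in> vectors" "m' \<in> vectors"
  shows "act a (\<lambda>z. m z \<oplus>\<^bsub>R\<^esub> m' z) = (\<lambda>z. act a m z \<oplus>\<^bsub>R\<^esub> act a m' z)"
  using assms
proof (induction arbitrary: m m' rule: lpa_terms.induct)
  case (Plus a b)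
  then show ?case by (simp add: act_closed R.a_ac)
next
  case (Times a b)
  then show ?case by (simp add: act_closed)
qed (auto simp: fun_eq_iff act_closed R.r_distr R.minus_add)

lemma act_smult:
  assumes "a \<in> lpa_terms R E" "m \<in> vectors" "r \<in> carrier R"
  shows "act a (\<lambda>z. r \<otimes>\<^bsub>R\<^esub> m z) = (\<lambda>z. r \<otimes>\<^bsub>R\<^esub> act a m z)"
  using assms
proof (induction arbitrary: m rule: lpa_terms.induct)
  case (Times a b)
  then show ?case by (simp add: act_closed)
qed (auto simp: fun_eq_iff act_closed R.m_lcomm R.r_distr R.r_minus)

text \<open>
  The summand of \<open>e\<close> restricts a function to the points whose code starts with \<open>e\<close>. Each point has
  exactly one first arc, which is why relation \<open>ck2\<close> holds.
\<close>

lemma act_foldr: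
  assumes "distinct es" "set es \<subseteq> out_arcs E v" "m \<in> vectors"
  shows "act (foldr (\<lambda>e a. Plus (Times (Edge e) (Ghost e)) a) es Zer) m (u, n, k) =
    (if u = v \<and> fst (decode u n) \<in> set es then m (u, n, k) else \<zero>\<^bsub>R\<^esub>)"
  using assms(1,2)
proof (induction es)
  case (Cons e es)
  then have e: "e \<in> out_arcs E v" by auto
  have "code e (snd (decode v n)) = n" if "fst (decode v n) = e"
  proof -
    have "out_arcs E v \<noteq> {}" using e by blast
    from code_decode(2)[OF this, of n] that show ?thesis by simp
  qed
  with Cons e show ?case using assms(3) by auto
qed simp

lemma act_cong:
  assumes "lpa_cong R E a b" "m \<in> vectors"
  shows "act a m = act b m"
  using assms
proof (induction arbitrary: m rule: lpa_cong.induct)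
  case (ck2 v es)
  have "out_arcs E v \<noteq> {}" using ck2.hyps(2,4) by (metis set_empty)
  then have "fst (decode v n) \<in> set es" for n
    using code_decode(1)[of v n] ck2.hyps(4) by simp
  moreover have "act (foldr (\<lambda>e a. Plus (Times (Edge e) (Ghost e)) a) es Zer) m (u, n, k) =
      (if u = v \<and> fst (decode u n) \<in> set es then m (u, n, k) else \<zero>\<^bsub>R\<^esub>)" for u n k
    using ck2 by (intro act_foldr) auto
  ultimately show ?case by (simp add: fun_eq_iff)
next
  case (cong_Times a a' b b')
  have "act b' m \<in> vectors"
    using lpa_cong_terms[OF leavitt_context cong_Times.hyps(2)] cong_Times.prems by (simp add: act_closed)
  with cong_Times show ?case by simp
next
  case (distrib_left a b c)
  then show ?case by (simp add: act_closed act_add)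
next
  case (Scale_Times_right r a b)
  then show ?case by (simp add: act_closed act_smult)
qed (auto simp: fun_eq_iff act_closed decode_code
    R.a_ac R.r_neg R.l_distr R.r_distr R.m_assoc)

definition rep :: "('r, 'v, 'e) lpa_term set \<Rightarrow> ('v \<times> nat \<times> int \<Rightarrow> 'r) \<Rightarrow> 'v \<times> nat \<times> int \<Rightarrow> 'r" where
  "rep x m = act (SOME a. a \<in> x) m"

lemma rep_class:
  assumes a: "a \<in> lpa_terms R E" and m: "m \<in> vectors"
  shows "rep (lpa_class R E a) m = act a m"
proof -
  have "a \<in> lpa_class R E a" using a by (auto simp: lpa_class_def lpa_rel_def intro: lpa_cong.refl)
  then have "(SOME b. b \<in> lpa_class R E a) \<in> lpa_class R E a" by (rule someI)
  then have "lpa_cong R E a (SOME b. b \<in> lpa_class R E a)"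
    by (simp add: lpa_class_def lpa_rel_def)
  from act_cong[OF this m] show ?thesis by (simp add: rep_def)
qed

lemma rep_closed:
  assumes "x \<in> carrier L" "m \<in> vectors"
  shows "rep x m \<in> vectors"
  using assms(1)
  by (rule leavitt_carrierE[OF leavitt_context]) (simp add: rep_class act_closed assms(2))

lemma rep_vertex:
  "w \<in> verts E \<Longrightarrow> m \<in> vectors \<Longrightarrow>
    rep (V w) m (u, n, k) = (if u = w then m (u, n, k) else \<zero>\<^bsub>R\<^esub>)"
  by (simp add: lpa_vertex_def rep_class lpa_terms.Vtx)

lemma rep_ghost:
  "e \<in> arcs E \<Longrightarrow> m \<in> vectors \<Longrightarrow>
    rep (lpa_ghost R E e) m (u, n, k) = (if u = head E e then m (tail E e, code e n, k + 1) else \<zero>\<^bsub>R\<^esub>)"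
  by (simp add: lpa_ghost_def rep_class lpa_terms.Ghost)

lemma rep_mult:
  assumes "x \<in> carrier L" "y \<in> carrier L" "m \<in> vectors"
  shows "rep (x \<otimes>\<^bsub>L\<^esub> y) m = rep x (rep y m)"
proof -
  obtain a b where "a \<in> lpa_terms R E" "x = lpa_class R E a" "b \<in> lpa_terms R E" "y = lpa_class R E b"
    using assms(1,2) by (elim leavitt_carrierE[OF leavitt_context]) blast
  then show ?thesis
    using assms(3) by (simp add: leavitt_mult[OF leavitt_context] rep_class lpa_terms.Times act_closed)
qed

lemma rep_smult:
  assumes "x \<in> carrier L" "r \<in> carrier R" "m \<in> vectors"
  shows "rep (r \<odot>\<^bsub>L\<^esub> x) m z = r \<otimes>\<^bsub>R\<^esub> rep x m z"
  using assms(1)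
  by (rule leavitt_carrierE[OF leavitt_context])
    (simp add: leavitt_smult[OF leavitt_context] rep_class lpa_terms.Scale assms(2,3))

lemma rep_add:
  assumes "x \<in> carrier L" "y \<in> carrier L" "m \<in> vectors"
  shows "rep (x \<oplus>\<^bsub>L\<^esub> y) m z = rep x m z \<oplus>\<^bsub>R\<^esub> rep y m z"
proof -
  obtain a b where "a \<in> lpa_terms R E" "x = lpa_class R E a" "b \<in> lpa_terms R E" "y = lpa_class R E b"
    using assms(1,2) by (elim leavitt_carrierE[OF leavitt_context]) blast
  then show ?thesis
    using assms(3) by (simp add: leavitt_add[OF leavitt_context] rep_class lpa_terms.Plus)
qed

lemma rep_minus:
  assumes "x \<in> carrier L" "y \<in> carrier L" "m \<in> vectors"
  shows "rep (x \<ominus>\<^bsub>L\<^esub> y) m z = rep x m z \<ominus>\<^bsub>R\<^esub> rep y m z"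
  using assms
  by (simp add: L.M.minus_eq L.a_inv_eq_smult rep_add rep_smult rep_closed R.minus_eq R.l_minus)

lemma rep_zero_vector:
  assumes "x \<in> carrier L"
  shows "rep x (\<lambda>z. \<zero>\<^bsub>R\<^esub>) = (\<lambda>z. \<zero>\<^bsub>R\<^esub>)"
proof -
  obtain a where a: "a \<in> lpa_terms R E" "x = lpa_class R E a"
    using assms by (rule leavitt_carrierE[OF leavitt_context])
  have "act a (\<lambda>z. \<zero>\<^bsub>R\<^esub> \<otimes>\<^bsub>R\<^esub> \<zero>\<^bsub>R\<^esub>) = (\<lambda>z. \<zero>\<^bsub>R\<^esub> \<otimes>\<^bsub>R\<^esub> act a (\<lambda>z. \<zero>\<^bsub>R\<^esub>) z)"
    using a by (intro act_smult) (auto simp: vectors_const)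
  with a show ?thesis by (simp add: rep_class act_closed vectors_const)
qed

text \<open>
  The function \<open>j\<close> describes how the path embeds the copy of the numbers at its end into the copy at its
  start. Its form is irrelevant as soon as the function acted on depends on the degree alone.
\<close>

lemma rep_ghost_elt:
  assumes "awalk u \<alpha> w" "m \<in> vectors"
  shows "\<exists>j. \<forall>u' n k. rep (L.ghost_elt u \<alpha>) m (u', n, k) =
    (if u' = w then m (u, j n, k + int (length \<alpha>)) else \<zero>\<^bsub>R\<^esub>)"
  using assms
proof (induction \<alpha> arbitrary: u m)
  case Nil
  then have "u = w" "w \<in> verts E" by (auto simp: awalk_Nil_iff)
  with Nil.prems(2) show ?case by (intro exI[of _ id]) (simp add: rep_vertex)
next
  case (Cons e \<alpha>)
  then have e: "e \<in> arcs E" "tail E e = u" and \<alpha>: "awalk (head E e) \<alpha> w" by (auto simp: awalk_simps)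
  let ?m = "rep (lpa_ghost R E e) m"
  have "?m \<in> vectors" using e Cons.prems(2) by (simp add: rep_closed L.t_closed)
  from Cons.IH[OF \<alpha> this] obtain j where j: "\<And>u' n k. rep (L.ghost_elt (head E e) \<alpha>) ?m (u', n, k) =
      (if u' = w then ?m (head E e, j n, k + int (length \<alpha>)) else \<zero>\<^bsub>R\<^esub>)"
    by blast
  show ?case
    using e \<alpha> Cons.prems(2) j
    by (intro exI[of _ "code e \<circ> j"])
      (simp add: rep_mult L.t_closed L.ghost_elt_closed[OF \<alpha>] rep_ghost algebra_simps)
qed

section \<open>Consequences of minimality\<close>

lemma smult_vertex_eq_zero:
  assumes "w \<in> verts E" "r \<in> carrier R" "r \<odot>\<^bsub>L\<^esub> V w = \<zero>\<^bsub>L\<^esub>"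
  shows "r = \<zero>\<^bsub>R\<^esub>"
proof -
  have "V w \<in> carrier L" using assms(1) by (simp add: L.p_closed)
  moreover have "rep (r \<odot>\<^bsub>L\<^esub> V w) (\<lambda>z. \<one>\<^bsub>R\<^esub>) (w, 0, 0) = rep (\<zero>\<^bsub>R\<^esub> \<odot>\<^bsub>L\<^esub> V w) (\<lambda>z. \<one>\<^bsub>R\<^esub>) (w, 0, 0)"
    using assms(3) L.smult_l_null[OF calculation] by simp
  ultimately show ?thesis
    using assms(1,2) by (simp only: rep_smult rep_vertex vectors_const R.one_closed R.zero_closed) simp
qed

lemma vertex_nonzero: "\<one>\<^bsub>R\<^esub> \<noteq> \<zero>\<^bsub>R\<^esub> \<Longrightarrow> w \<in> verts E \<Longrightarrow> V w \<noteq> \<zero>\<^bsub>L\<^esub>"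
  using smult_vertex_eq_zero[of w "\<one>\<^bsub>R\<^esub>"] by (auto simp: L.p_closed)

text \<open>
  Some left multiple of \<open>r v\<close> is \<open>v\<close>. Evaluating its action on the constant function \<open>1\<close> at a point over
  \<open>v\<close> exhibits an inverse of \<open>r\<close>.
\<close>

lemma minimal_imp_field:
  assumes v: "v \<in> verts E" and min: "minimal_left_ideal {x \<otimes>\<^bsub>L\<^esub> V v | x. x \<in> carrier L} L"
  shows "field R"
proof (rule R.cring_fieldI)
  have vc: "V v \<in> carrier L" and vv: "V v \<otimes>\<^bsub>L\<^esub> V v = V v"
    using v by (simp_all add: L.p_closed L.p_mult)
  have nz: "V v \<noteq> \<zero>\<^bsub>L\<^esub>" using min by (simp add: minimal_left_ideal_iff[OF v])
  have one: "\<one>\<^bsub>R\<^esub> \<noteq> \<zero>\<^bsub>R\<^esub>"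
    using nz vc by (metis L.smult_l_null L.smult_one)
  have "r \<in> Units R" if r: "r \<in> carrier R" "r \<noteq> \<zero>\<^bsub>R\<^esub>" for r
  proof -
    have "r \<odot>\<^bsub>L\<^esub> V v \<noteq> \<zero>\<^bsub>L\<^esub>" using smult_vertex_eq_zero[OF v] r by blast
    moreover have "r \<odot>\<^bsub>L\<^esub> V v \<in> carrier L" "(r \<odot>\<^bsub>L\<^esub> V v) \<otimes>\<^bsub>L\<^esub> V v = r \<odot>\<^bsub>L\<^esub> V v"
      using r vc vv by (simp_all add: L.smult_mult_left)
    ultimately obtain y where y: "y \<in> carrier L" "y \<otimes>\<^bsub>L\<^esub> (r \<odot>\<^bsub>L\<^esub> V v) = V v"
      using min unfolding minimal_left_ideal_iff[OF v] by blast
    let ?one = "\<lambda>z. \<one>\<^bsub>R\<^esub>" and ?c = "rep (y \<otimes>\<^bsub>L\<^esub> V v) (\<lambda>z. \<one>\<^bsub>R\<^esub>) (v, 0, 0)"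
    have yv: "y \<otimes>\<^bsub>L\<^esub> V v \<in> carrier L" using y vc by (simp add: L.mult_closed)
    have "r \<odot>\<^bsub>L\<^esub> (y \<otimes>\<^bsub>L\<^esub> V v) = V v" using y r vc by (simp add: L.smult_mult_right)
    then have "rep (r \<odot>\<^bsub>L\<^esub> (y \<otimes>\<^bsub>L\<^esub> V v)) ?one (v, 0, 0) = rep (V v) ?one (v, 0, 0)" by (simp only:)
    then have rc: "r \<otimes>\<^bsub>R\<^esub> ?c = \<one>\<^bsub>R\<^esub>" using r v yv by (simp add: rep_smult rep_vertex vectors_const)
    have c: "?c \<in> carrier R" using yv by (simp add: rep_closed vectors_const)
    with rc r R.m_comm[OF c] have "?c \<otimes>\<^bsub>R\<^esub> r = \<one>\<^bsub>R\<^esub>" by simp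
    with rc c r show ?thesis unfolding Units_def by blast
  qed
  moreover have "\<zero>\<^bsub>R\<^esub> \<notin> Units R" using one by (auto simp: Units_def)
  ultimately show "Units R = carrier R - {\<zero>\<^bsub>R\<^esub>}" by (auto simp: Units_def)
qed

text \<open>
  For a path \<open>\<alpha>\<close> from \<open>v\<close> to \<open>w\<close>, multiplication by \<open>\<alpha>*\<close> carries \<open>L w\<close> injectively into \<open>L v\<close>, as
  multiplication by \<open>\<alpha>\<close> undoes it. From \<open>y x \<alpha>* = v\<close> one gets \<open>(\<alpha>* y) x = w\<close>.
\<close>

lemma minimal_at_end_of_walk:
  assumes min: "minimal_left_ideal {x \<otimes>\<^bsub>L\<^esub> V v | x. x \<in> carrier L} L" and \<alpha>: "awalk v \<alpha> w"
  shows "minimal_left_ideal {x \<otimes>\<^bsub>L\<^esub> V w | x. x \<in> carrier L} L"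
proof -
  have vE: "v \<in> verts E" and wE: "w \<in> verts E" using \<alpha> by auto
  interpret F: field R by (rule minimal_imp_field[OF vE min])
  have "\<exists>y\<in>carrier L. y \<otimes>\<^bsub>L\<^esub> x = V w"
    if x: "x \<in> carrier L" "x \<otimes>\<^bsub>L\<^esub> V w = x" "x \<noteq> \<zero>\<^bsub>L\<^esub>" for x
  proof -
    let ?p = "L.path_elt v \<alpha>" and ?g = "L.ghost_elt v \<alpha>"
    note cl = x(1) L.p_closed[OF vE] L.p_closed[OF wE] L.mult_closed
      L.path_elt_closed[OF \<alpha>] L.ghost_elt_closed[OF \<alpha>]
    have xgp: "x \<otimes>\<^bsub>L\<^esub> ?g \<otimes>\<^bsub>L\<^esub> ?p = x"
      using cl x(2) L.ghost_path_elt[OF \<alpha>] by (simp add: L.mult_assoc)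
    then have "x \<otimes>\<^bsub>L\<^esub> ?g \<noteq> \<zero>\<^bsub>L\<^esub>" using x(3) cl L.zero_mult by metis
    moreover have "x \<otimes>\<^bsub>L\<^esub> ?g \<otimes>\<^bsub>L\<^esub> V v = x \<otimes>\<^bsub>L\<^esub> ?g"
      using cl L.ghost_elt_vertex[OF \<alpha>] by (simp add: L.mult_assoc)
    moreover have "x \<otimes>\<^bsub>L\<^esub> ?g \<in> carrier L" using cl by simp
    ultimately obtain y where y: "y \<in> carrier L" "y \<otimes>\<^bsub>L\<^esub> (x \<otimes>\<^bsub>L\<^esub> ?g) = V v"
      using min unfolding minimal_left_ideal_iff[OF vE] by blast
    have "?g \<otimes>\<^bsub>L\<^esub> y \<otimes>\<^bsub>L\<^esub> x = ?g \<otimes>\<^bsub>L\<^esub> y \<otimes>\<^bsub>L\<^esub> (x \<otimes>\<^bsub>L\<^esub> ?g \<otimes>\<^bsub>L\<^esub> ?p)" by (simp only: xgp)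
    also have "\<dots> = ?g \<otimes>\<^bsub>L\<^esub> (y \<otimes>\<^bsub>L\<^esub> (x \<otimes>\<^bsub>L\<^esub> ?g)) \<otimes>\<^bsub>L\<^esub> ?p"
      using cl y(1) by (simp add: L.mult_assoc)
    also have "\<dots> = V w"
      by (simp only: y(2) L.ghost_elt_vertex[OF \<alpha>] L.ghost_path_elt[OF \<alpha>])
    finally show ?thesis using cl y(1) by (intro bexI[of _ "?g \<otimes>\<^bsub>L\<^esub> y"]) simp_all
  qed
  then show ?thesis
    using vertex_nonzero[OF F.one_not_zero wE] by (simp add: minimal_left_ideal_iff[OF wE])
qed

text \<open>
  If \<open>w = y e e*\<close>, then \<open>f = w f = y e (e* f) = 0\<close> for every other arc \<open>f\<close> leaving \<open>w\<close>.
\<close>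

lemma minimal_imp_no_bifurcation:
  assumes w: "w \<in> verts E" and min: "minimal_left_ideal {x \<otimes>\<^bsub>L\<^esub> V w | x. x \<in> carrier L} L"
  shows "\<not> bifurcation E w"
proof
  assume "bifurcation E w"
  then obtain e f where ef: "e \<in> arcs E" "tail E e = w" "f \<in> arcs E" "tail E f = w" "e \<noteq> f"
    by (auto simp: bifurcation_def)
  interpret F: field R by (rule minimal_imp_field[OF w min])
  let ?s = "lpa_edge R E" and ?t = "lpa_ghost R E"
  note cl = L.p_closed L.s_closed L.t_closed L.mult_closed ef
  have "?t e \<otimes>\<^bsub>L\<^esub> (?s e \<otimes>\<^bsub>L\<^esub> ?t e) \<otimes>\<^bsub>L\<^esub> ?s e = V (head E e)"
    using cl by (simp add: L.t_s L.p_t flip: L.mult_assoc)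
  moreover have "V (head E e) \<noteq> \<zero>\<^bsub>L\<^esub>" using vertex_nonzero[OF F.one_not_zero] ef by simp
  ultimately have "?s e \<otimes>\<^bsub>L\<^esub> ?t e \<noteq> \<zero>\<^bsub>L\<^esub>"
    using cl L.zero_mult L.mult_zero by metis
  moreover have "?s e \<otimes>\<^bsub>L\<^esub> ?t e \<otimes>\<^bsub>L\<^esub> V w = ?s e \<otimes>\<^bsub>L\<^esub> ?t e"
    using cl w L.t_p[of e] by (simp add: L.mult_assoc)
  moreover have "?s e \<otimes>\<^bsub>L\<^esub> ?t e \<in> carrier L" using cl by simp
  ultimately obtain y where y: "y \<in> carrier L" "y \<otimes>\<^bsub>L\<^esub> (?s e \<otimes>\<^bsub>L\<^esub> ?t e) = V w"
    using min unfolding minimal_left_ideal_iff[OF w] by blast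
  have "?s f = V w \<otimes>\<^bsub>L\<^esub> ?s f" using ef L.p_s[of f] by simp
  also have "\<dots> = y \<otimes>\<^bsub>L\<^esub> (?s e \<otimes>\<^bsub>L\<^esub> ?t e) \<otimes>\<^bsub>L\<^esub> ?s f" by (simp only: y(2))
  also have "\<dots> = y \<otimes>\<^bsub>L\<^esub> (?s e \<otimes>\<^bsub>L\<^esub> (?t e \<otimes>\<^bsub>L\<^esub> ?s f))" using cl y(1) by (simp add: L.mult_assoc)
  also have "\<dots> = \<zero>\<^bsub>L\<^esub>" using cl y(1) by (simp add: L.t_s L.mult_zero)
  finally have "?s f = \<zero>\<^bsub>L\<^esub>" .
  then have "V (head E f) = \<zero>\<^bsub>L\<^esub>" using L.t_s[of f f] ef L.mult_zero[of "?t f"] L.t_closed by simp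
  then show False using vertex_nonzero[OF F.one_not_zero] ef by simp
qed

text \<open>
  The grading distinguishes \<open>w\<close> from \<open>\<gamma>*\<close>, which lowers the degree by the length of \<open>\<gamma>\<close>. On the constant
  function \<open>1\<close>, however, both act as restriction to the points over \<open>w\<close>, so every left multiple of
  \<open>w - \<gamma>*\<close> kills that function, and \<open>w\<close> does not.
\<close>

lemma minimal_imp_no_closed_path:
  assumes w: "w \<in> verts E" and min: "minimal_left_ideal {x \<otimes>\<^bsub>L\<^esub> V w | x. x \<in> carrier L} L"
  shows "\<not> closed_path_base E w"
proof
  assume "closed_path_base E w"
  then obtain \<gamma> where \<gamma>: "\<gamma> \<noteq> []" "awalk w \<gamma> w" by (auto simp: closed_path_base_def)
  interpret F: field R by (rule minimal_imp_field[OF w min])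
  let ?g = "L.ghost_elt w \<gamma>"
  let ?x = "V w \<ominus>\<^bsub>L\<^esub> ?g"
  let ?one = "\<lambda>z :: 'v \<times> nat \<times> int. \<one>\<^bsub>R\<^esub>"
  have cl: "V w \<in> carrier L" "?g \<in> carrier L" using w L.p_closed L.ghost_elt_closed[OF \<gamma>(2)] by auto
  have "?x \<noteq> \<zero>\<^bsub>L\<^esub>"
  proof
    assume "?x = \<zero>\<^bsub>L\<^esub>"
    moreover have "V w = ?x \<oplus>\<^bsub>L\<^esub> ?g"
      using cl by (simp add: L.M.minus_eq L.M.a_assoc L.M.l_neg)
    ultimately have eq: "V w = ?g" using cl by simp
    \<comment> \<open>The indicator function of degree \<open>0\<close>; \<open>w\<close> preserves the degree, and \<open>?g\<close> does not.\<close>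
    let ?m = "\<lambda>(u :: 'v, n :: nat, k :: int). if k = 0 then \<one>\<^bsub>R\<^esub> else \<zero>\<^bsub>R\<^esub>"
    have m: "?m \<in> vectors" by (rule vectorsI) (auto split: prod.split)
    obtain j where "\<And>u n k. rep ?g ?m (u, n, k) =
        (if u = w then ?m (w, j n, k + int (length \<gamma>)) else \<zero>\<^bsub>R\<^esub>)"
      using rep_ghost_elt[OF \<gamma>(2) m] by blast
    then have "rep ?g ?m (w, 0, 0) = \<zero>\<^bsub>R\<^esub>" using \<gamma>(1) by simp
    moreover have "rep (V w) ?m (w, 0, 0) = \<one>\<^bsub>R\<^esub>" using rep_vertex[OF w m] by simp
    ultimately show False using eq F.one_not_zero by simp
  qed
  moreover have "?x \<otimes>\<^bsub>L\<^esub> V w = ?x"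
    using cl L.ghost_elt_vertex[OF \<gamma>(2)] w by (simp add: L.mult_minus_left L.p_mult)
  moreover have "?x \<in> carrier L" using cl by simp
  ultimately obtain y where y: "y \<in> carrier L" "y \<otimes>\<^bsub>L\<^esub> ?x = V w"
    using min unfolding minimal_left_ideal_iff[OF w] by blast
  have one: "?one \<in> vectors" by (simp add: vectors_const)
  obtain j where "\<And>u n k. rep ?g ?one (u, n, k) = (if u = w then \<one>\<^bsub>R\<^esub> else \<zero>\<^bsub>R\<^esub>)"
    using rep_ghost_elt[OF \<gamma>(2) one] by blast
  then have "rep ?x ?one z = \<zero>\<^bsub>R\<^esub>" for z
    using cl w one by (cases z) (simp add: rep_minus rep_vertex R.minus_eq R.r_neg)
  then have "rep ?x ?one = (\<lambda>z. \<zero>\<^bsub>R\<^esub>)" by (rule ext)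
  then have "rep (y \<otimes>\<^bsub>L\<^esub> ?x) ?one = (\<lambda>z. \<zero>\<^bsub>R\<^esub>)"
    using y(1) cl one by (simp add: rep_mult rep_zero_vector)
  then have "rep (V w) ?one (w, 0, 0) = \<zero>\<^bsub>R\<^esub>" by (simp only: y(2))
  then show False using rep_vertex[OF w one] F.one_not_zero by simp
qed

lemma minimal_imp_line_point:
  assumes v: "v \<in> verts E" and min: "minimal_left_ideal {x \<otimes>\<^bsub>L\<^esub> V v | x. x \<in> carrier L} L"
  shows "v \<in> line_points E"
  using v minimal_at_end_of_walk[OF min] minimal_imp_no_bifurcation minimal_imp_no_closed_path
  by (auto simp: line_points_def vertex_tree_def)

end

section \<open>The equivalence\<close>

theorem proposition5p6:
  fixes R :: "('r, 'x) ring_scheme" and E :: "('v, 'e) pre_digraph" and v :: 'v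
  defines "L \<equiv> leavitt R E"
  defines "pv \<equiv> lpa_vertex R E v"
  assumes "cring R"
    and "wf_digraph E" and "countable (verts E)" and "countable (arcs E)"
    and "v \<in> verts E"
  shows "(minimal_left_ideal {x \<otimes>\<^bsub>L\<^esub> pv | x. x \<in> carrier L} L
        \<longleftrightarrow> minimal_right_ideal {pv \<otimes>\<^bsub>L\<^esub> x | x. x \<in> carrier L} L)
    \<and> (minimal_right_ideal {pv \<otimes>\<^bsub>L\<^esub> x | x. x \<in> carrier L} L
        \<longleftrightarrow> v \<in> line_points E \<and> field R)
    \<and> (v \<in> line_points E \<and> field R
        \<longleftrightarrow> {pv \<otimes>\<^bsub>L\<^esub> x \<otimes>\<^bsub>L\<^esub> pv | x. x \<in> carrier L} = {r \<odot>\<^bsub>L\<^esub> pv | r. r \<in> carrier R} \<and> field R)"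
proof -
  interpret cring R by fact
  interpret wf_digraph E by fact
  interpret G: countable_leavitt_graph R E
    by unfold_locales fact
  let ?min = "minimal_left_ideal {x \<otimes>\<^bsub>L\<^esub> pv | x. x \<in> carrier L} L"
  let ?line = "v \<in> line_points E \<and> field R"
  let ?corner = "{pv \<otimes>\<^bsub>L\<^esub> x \<otimes>\<^bsub>L\<^esub> pv | x. x \<in> carrier L} = {r \<odot>\<^bsub>L\<^esub> pv | r. r \<in> carrier R} \<and> field R"
  have "?min \<longleftrightarrow> minimal_right_ideal {pv \<otimes>\<^bsub>L\<^esub> x | x. x \<in> carrier L} L"
    unfolding L_def pv_def by (rule G.minimal_left_iff_minimal_right) fact
  moreover have "?min \<Longrightarrow> ?line"
    unfolding L_def pv_def
    using G.minimal_imp_line_point G.minimal_imp_field \<open>v \<in> verts E\<close> by blast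
  moreover have "?line \<Longrightarrow> ?corner"
    unfolding L_def pv_def using G.line_point_corner by blast
  moreover have "?corner \<Longrightarrow> ?min"
  proof -
    assume c: ?corner
    then interpret F: field R by simp
    have "lpa_vertex R E v \<noteq> \<zero>\<^bsub>leavitt R E\<^esub>"
      by (rule G.vertex_nonzero[OF F.one_not_zero]) fact
    with c show ?min
      unfolding L_def pv_def using G.corner_imp_minimal \<open>v \<in> verts E\<close> by simp
  qed
  ultimately show ?thesis by blast
qed

end
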